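(* Let $\mathcal V=(d,Q,T)$ be an affine $\mathbb Z$-VASS with the finite-monoid property, and let $p,q\in Q$. Then there exist a $\mathbb Z$-VASS $\mathcal V'=(d',Q',T')$ and control-states $p',q'\in Q'$ such that (i) $d'=2d$; (ii) $|Q'|\le 3\cdot|\mathcal M_{\mathcal V}|\cdot|Q|$; (iii) $|T'|\le 4d\cdot|\mathcal M_{\mathcal V}|\cdot(|Q|+|T|)$; (iv) $\|T'\|\le \|\mathcal M_{\mathcal V}\|\cdot\|T\|$; (v) for all $\mathbf u,\mathbf v\in\mathbb Z^d$: $p(\mathbf u)\xrightarrow{*}q(\mathbf v)$ in $\mathcal V$ if and only if $p'(\mathbf u,\mathbf 0)\xrightarrow{*}q'(\mathbf 0,\mathbf v)$ in $\mathcal V'$. Moreover, $\mathcal V'$, $p'$ and $q'$ are effectively computable from $\mathcal V$ (and $p,q$).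
   Context: An affine $\mathbb Z$-VASS is a triple $\mathcal V=(d,Q,T)$ with $d\in\mathbb N$, $Q$ a finite set of control-states and $T\subseteq Q\times\mathbb Z^{d\times d}\times\mathbb Z^d\times Q$ a finite set of transitions. For $t=(p,A,\mathbf b,q)\in T$, a configuration is a pair $(q,\mathbf v)\in Q\times\mathbb Z^d$ written $q(\mathbf v)$, and $p(\mathbf u)\xrightarrow{t}q(\mathbf v)$ holds iff $t=(p,A,\mathbf b,q)$ and $\mathbf v=A\mathbf u+\mathbf b$. For $w=w_1\cdots w_k\in T^*$, $p(\mathbf u)\xrightarrow{w}q(\mathbf v)$ iff either $k=0$ and $p(\mathbf u)=q(\mathbf v)$, or there are configurations $p(\mathbf u)=c_0\xrightarrow{w_1}c_1\xrightarrow{w_2}\cdots\xrightarrow{w_k}c_k=q(\mathbf v)$; and $p(\mathbf u)\xrightarrow{*}q(\mathbf v)$ iff $p(\mathbf u)\xrightarrow{w}q(\mathbf v)$ for some $w\in T^*$. The monoid $\mathcal M_{\mathcal V}$ is the smallest set of matrices containing the identity and all matrices occurring in transitions of $T$ and closed under matrix multiplication; $\mathcal V$ has the finite-monoid property if $\mathcal M_{\mathcal V}$ is finite. A $\mathbb Z$-VASS is an affine $\mathbb Z$-VASS all of whose transition matrices are the identity matrix. Norms: for $\mathbf x\in\mathbb Z^d$, $\|\mathbf x\|=\max_i|\mathbf x(i)|$; for a matrix $A$, $\|A\|$ is the maximum of $\|A_i\|$ over the columns $A_i$ of $A$; for a finite set $G$ of matrices, $\|G\|=\max_{A\in G}\|A\|$;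 for a transition set $T$, $\|T\|$ is the maximum of $\|\mathbf b\|$ and $\|A\|$ over all $(p,A,\mathbf b,q)\in T$. For $\mathbf u,\mathbf v\in\mathbb Z^d$, $(\mathbf u,\mathbf v)\in\mathbb Z^{2d}$ denotes their concatenation.
   Formalization: Clause (iv) is false as stated; it is replaced by ‖T'‖ ≤ d·‖M_V‖·max(1,‖T‖), with the original bound ‖T'‖ ≤ ‖M_V‖·‖T‖ kept whenever ‖T‖ ≥ 1 and ‖Bb‖ ≤ ‖M_V‖·‖T‖ for all B in M_V and all translation vectors b of T. *)

theory Defs
  imports
    Complex_Main
    "HOL-Library.Nat_Bijection"
    "Jordan_Normal_Form.Matrix"
begin

section \<open>Affine integer VASS\<close>

type_synonym 'q transition = "'q \<times> int mat \<times> int vec \<times> 'q"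

type_synonym 'q config = "'q \<times> int vec"

record 'q vass =
  dimension :: nat
  states :: "'q set"
  transitions :: "'q transition set"

definition affine_zvass :: "'q vass \<Rightarrow> bool" where
  "affine_zvass V \<longleftrightarrow>
     finite (states V) \<and> finite (transitions V) \<and>
     transitions V \<subseteq> states V \<times> carrier_mat (dimension V) (dimension V)
                       \<times> carrier_vec (dimension V) \<times> states V"

definition zvass :: "'q vass \<Rightarrow> bool" where
  "zvass V \<longleftrightarrow> affine_zvass V \<and> (\<forall>(p, A, b, q) \<in> transitions V. A = 1\<^sub>m (dimension V))"

definition configs :: "'q vass \<Rightarrow> 'q config set" where
  "configs V = states V \<times> carrier_vec (dimension V)"

definition step :: "'q transition \<Rightarrow> 'q config \<Rightarrow> 'q config \<Rightarrow> bool" where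
  "step t c c' \<longleftrightarrow> (\<exists>A b. t = (fst c, A, b, fst c') \<and> snd c' = A *\<^sub>v snd c + b)"

fun run :: "'q vass \<Rightarrow> 'q transition list \<Rightarrow> 'q config \<Rightarrow> 'q config \<Rightarrow> bool" where
  "run V [] c c' \<longleftrightarrow> c \<in> configs V \<and> c = c'"
| "run V (t # w) c c' \<longleftrightarrow>
     c \<in> configs V \<and> t \<in> transitions V \<and> (\<exists>c''. step t c c'' \<and> run V w c'' c')"

definition reach :: "'q vass \<Rightarrow> 'q config \<Rightarrow> 'q config \<Rightarrow> bool" where
  "reach V c c' \<longleftrightarrow> (\<exists>w. run V w c c')"

inductive_set mat_monoid :: "'q vass \<Rightarrow> int mat set" for V :: "'q vass" where
  one: "1\<^sub>m (dimension V) \<in> mat_monoid V"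
| gen: "(p, A, b, q) \<in> transitions V \<Longrightarrow> A \<in> mat_monoid V"
| mult: "A \<in> mat_monoid V \<Longrightarrow> B \<in> mat_monoid V \<Longrightarrow> A * B \<in> mat_monoid V"

definition finite_monoid_property :: "'q vass \<Rightarrow> bool" where
  "finite_monoid_property V \<longleftrightarrow> finite (mat_monoid V)"


section \<open>Norms\<close>

text \<open>All norms are nonnegative, so inserting 0 only fixes the value of an empty maximum
  (dimension 0, or no transitions).\<close>

definition norm_vec :: "int vec \<Rightarrow> int" where
  "norm_vec x = Max (insert 0 {\<bar>x $ i\<bar> | i. i < dim_vec x})"

definition norm_mat :: "int mat \<Rightarrow> int" where
  "norm_mat A = Max (insert 0 (norm_vec ` set (cols A)))"

definition norm_mats :: "int mat set \<Rightarrow> int" where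
  "norm_mats G = Max (insert 0 (norm_mat ` G))"

definition norm_trans :: "'q transition set \<Rightarrow> int" where
  "norm_trans T = Max (insert 0 (\<Union>(p, A, b, q) \<in> T. {norm_vec b, norm_mat A}))"


section \<open>Partial recursive functions\<close>

text \<open>Kleene's partial recursive functions, presented as unary functions: several arguments are
  passed through the (primitive recursive) Cantor pairing \<^const>\<open>prod_encode\<close>, and the
  projections play the role of the usual coordinate functions. The value \<^const>\<open>None\<close> means
  that the computation diverges.\<close>

inductive partial_recursive :: "(nat \<Rightarrow> nat option) \<Rightarrow> bool" where
  zero: "partial_recursive (\<lambda>_. Some 0)"
| succ: "partial_recursive (\<lambda>n. Some (Suc n))"
| left: "partial_recursive (\<lambda>n. Some (fst (prod_decode n)))"
| right: "partial_recursive (\<lambda>n. Some (snd (prod_decode n)))"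
| pair: "partial_recursive f \<Longrightarrow> partial_recursive g \<Longrightarrow>
    partial_recursive
      (\<lambda>n. Option.bind (f n) (\<lambda>a. Option.bind (g n) (\<lambda>b. Some (prod_encode (a, b)))))"
| comp: "partial_recursive f \<Longrightarrow> partial_recursive g \<Longrightarrow>
    partial_recursive (\<lambda>n. Option.bind (g n) f)"
| prim_rec: "partial_recursive f \<Longrightarrow> partial_recursive g \<Longrightarrow>
    partial_recursive
      (\<lambda>n. case prod_decode n of (a, k) \<Rightarrow>
         rec_nat (f a) (\<lambda>y r. Option.bind r (\<lambda>z. g (prod_encode (a, prod_encode (y, z))))) k)"
| minimise: "partial_recursive f \<Longrightarrow>
    partial_recursive
      (\<lambda>a. if \<exists>n. f (prod_encode (a, n)) = Some 0 \<and>
                  (\<forall>m<n. f (prod_encode (a, m)) \<noteq> None)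
           then Some (LEAST n. f (prod_encode (a, n)) = Some 0)
           else None)"


section \<open>Finite presentations\<close>

definition code_vec :: "int vec \<Rightarrow> nat" where
  "code_vec x = list_encode (map int_encode (list_of_vec x))"

definition code_mat :: "int mat \<Rightarrow> nat" where
  "code_mat A = list_encode (map code_vec (rows A))"

text \<open>The function \<^term>\<open>\<nu>\<close> gives the control-states, which may come from any type, the
  names under which they are handed to an algorithm.\<close>

definition code_transition :: "('q \<Rightarrow> nat) \<Rightarrow> 'q transition \<Rightarrow> nat" where
  "code_transition \<nu> t = (case t of (p, A, b, q) \<Rightarrow>
     prod_encode (\<nu> p, prod_encode (code_mat A, prod_encode (code_vec b, \<nu> q))))"

definition code_vass :: "('q \<Rightarrow> nat) \<Rightarrow> 'q vass \<Rightarrow> nat" where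
  "code_vass \<nu> V =
     prod_encode (dimension V,
       prod_encode (set_encode (\<nu> ` states V), set_encode (code_transition \<nu> ` transitions V)))"

definition code_instance :: "('q \<Rightarrow> nat) \<Rightarrow> 'q vass \<Rightarrow> 'q \<Rightarrow> 'q \<Rightarrow> nat" where
  "code_instance \<nu> V p q = prod_encode (code_vass \<nu> V, prod_encode (\<nu> p, \<nu> q))"

end

theory Submission
  imports Defs
begin

text \<open>Read a path from \<open>p\<close> to \<open>q\<close> backwards. The matrix \<open>M\<close> composed so far ranges over the
  finite monoid, hence fits into the control-state, and a further transition \<open>(r, A, b, s)\<close> adds
  the constant vector \<open>M b\<close> to the effect and replaces \<open>M\<close> by \<open>M A\<close>. So an integer VASS can guess
  the path backwards; once at \<open>p\<close> it still has to turn the initial vector \<open>u\<close> into \<open>M u\<close>, which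
  loops with effects \<open>(- x, M x)\<close> for signed unit vectors \<open>x\<close> do.

  The construction never computes the monoid: the set of reachable pairs of a state and a matrix is
  finite, and an unbounded search finds the number of rounds after which it is closed. To keep this
  away from numberings, partial recursive functions are lifted to maps between encoded types.\<close>

section \<open>Computable functions on encoded types\<close>

text \<open>Reading forwards fails because a translation is later multiplied by every matrix still
  to come, which is unknown when it is added; reading backwards, that product is exactly what has
  been read already. So the endpoints swap roles: the simulation starts at a copy of
  \<open>q\<close> and may stop reading at any copy of \<open>p\<close>. Doubling the dimension
  keeps the untouched input \<open>u\<close> apart from the accumulated effect.

  Two facts shape the norm bounds. A coordinate of \<open>M b\<close> is a sum of \<open>d\<close>
  products, so the general bound carries a factor \<open>d\<close>, and the bound without it is tied
  to an estimate on these products. The loops on signed unit vectors can have entries as large as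
  those of \<open>M\<close> even if all transitions vanish, hence the \<open>max 1\<close>.

  The algorithm is uniform: one partial recursive function is fixed before the machine and the names
  of its states. The round at which the search stops does not show in the result, because the output
  is coded through finite sets, which forget order and repetition.\<close>

class coded =
  fixes enc :: "'a \<Rightarrow> nat"
  assumes bij_enc: "bij enc"

text \<open>Since \<open>enc\<close> is bijective and not merely injective, every number is a valid
  code, and functions on codes need no case for malformed input.\<close>

definition dec :: "nat \<Rightarrow> 'a::coded" where
  "dec = inv_into UNIV enc"

lemma dec_enc [simp]: "dec (enc x) = x"
  unfolding dec_def by (rule inv_f_f[OF bij_is_inj[OF bij_enc]])

lemma enc_dec [simp]: "enc (dec n :: 'a::coded) = n"
  unfolding dec_def by (rule surj_f_inv_f[OF bij_is_surj[OF bij_enc]])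

lemma enc_eq_iff [simp]: "enc x = enc y \<longleftrightarrow> x = y"
  by (metis dec_enc)

instantiation nat :: coded
begin
definition enc_nat :: "nat \<Rightarrow> nat" where "enc_nat n = n"
instance by standard (simp add: enc_nat_def[abs_def] bij_id[unfolded id_def])
end

instantiation int :: coded
begin
definition enc_int :: "int \<Rightarrow> nat" where "enc_int = int_encode"
instance by standard (simp add: enc_int_def bij_int_encode)
end

instantiation prod :: (coded, coded) coded
begin
definition enc_prod :: "'a \<times> 'b \<Rightarrow> nat" where "enc_prod z = prod_encode (enc (fst z), enc (snd z))"
instance
proof
  show "bij (enc :: 'a \<times> 'b \<Rightarrow> nat)"
    by (rule bij_betw_byWitness[where f' = "\<lambda>n. (dec (fst (prod_decode n)), dec (snd (prod_decode n)))"])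
      (auto simp: enc_prod_def)
qed
end

instantiation list :: (coded) coded
begin
definition enc_list :: "'a list \<Rightarrow> nat" where "enc_list xs = list_encode (map enc xs)"
instance
proof
  show "bij (enc :: 'a list \<Rightarrow> nat)"
    by (rule bij_betw_byWitness[where f' = "\<lambda>n. map dec (list_decode n)"])
      (auto simp: enc_list_def o_def)
qed
end

lemma enc_Pair: "enc (a, b) = prod_encode (enc a, enc b)"
  by (simp add: enc_prod_def)

lemma enc_Nil: "enc [] = 0"
  by (simp add: enc_list_def)

lemma enc_Cons: "enc (x # xs) = Suc (enc (x, xs))"
  by (simp add: enc_list_def enc_prod_def)

lemma enc_length: "length xs \<le> enc xs"
proof (induction xs)
  case (Cons x xs)
  then show ?case
    using le_prod_encode_2[of "enc xs" "enc x"] by (simp add: enc_Cons enc_Pair)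
qed simp

text \<open>Only total functions are captured. Divergence can enter through unbounded search alone,
  which is kept out of this calculus and treated separately.\<close>

definition computable :: "('a::coded \<Rightarrow> 'b::coded) \<Rightarrow> bool" where
  "computable f \<longleftrightarrow> partial_recursive (\<lambda>n. Some (enc (f (dec n))))"

definition decidable :: "('a::coded \<Rightarrow> bool) \<Rightarrow> bool" where
  "decidable P \<longleftrightarrow> computable (\<lambda>x. of_bool (P x) :: nat)"

named_theorems computable_intros

lemma computable_comp:
  assumes "computable f" "computable g"
  shows "computable (\<lambda>x. f (g x))"
  using partial_recursive.comp[OF assms[unfolded computable_def]] by (simp add: computable_def)

text \<open>Computability depends only on the action on codes, so a function may be exchanged for
  one between different types that acts equally on the numbers. This is how operations on integers
  and lists are reduced to arithmetic.\<close>

lemma computable_recode: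
  fixes f :: "'a::coded \<Rightarrow> 'b::coded" and g :: "'c::coded \<Rightarrow> 'd::coded"
  assumes "computable g" "\<And>x. enc (f x) = enc (g (dec (enc x)))"
  shows "computable f"
proof -
  have "enc (f (dec n)) = enc (g (dec n))" for n
    using assms(2)[of "dec n"] by simp
  then show ?thesis using assms(1) by (simp add: computable_def)
qed

lemma computable_id [computable_intros]: "computable (\<lambda>x. x)"
  using partial_recursive.pair[OF partial_recursive.left partial_recursive.right]
  by (simp add: computable_def)

lemma computable_const [computable_intros]: "computable (\<lambda>x. c)"
proof -
  have "partial_recursive (\<lambda>n. Some m)" for m
  proof (induction m)
    case (Suc m)
    show ?case using partial_recursive.comp[OF partial_recursive.succ Suc] by simp
  qed (rule partial_recursive.zero)
  then show ?thesis by (simp add: computable_def)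
qed

lemma dec_nat [simp]: "dec n = (n :: nat)"
  by (metis dec_enc enc_nat_def)

lemma computable_dec [computable_intros]:
  fixes f :: "_ \<Rightarrow> nat"
  assumes "computable f" shows "computable (\<lambda>x. dec (f x))"
  by (rule computable_recode[OF assms]) (simp add: enc_nat_def)

lemma computable_enc [computable_intros]:
  assumes "computable f" shows "computable (\<lambda>x. enc (f x))"
  by (rule computable_recode[OF assms]) (simp add: enc_nat_def)

lemma computable_Suc [computable_intros]:
  assumes "computable f" shows "computable (\<lambda>x. Suc (f x))"
proof -
  have "computable Suc"
    using partial_recursive.succ by (simp add: computable_def enc_nat_def)
  from computable_comp[OF this assms] show ?thesis .
qed

lemma dec_prod: "dec n = (dec (fst (prod_decode n)), dec (snd (prod_decode n)))"
  by (metis enc_Pair dec_enc enc_dec prod.collapse prod_decode_inverse)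

lemma computable_fst [computable_intros]:
  assumes "computable f" shows "computable (\<lambda>x. fst (f x))"
proof -
  have "computable (fst :: 'b \<times> 'c \<Rightarrow> 'b)"
    using partial_recursive.left by (simp add: computable_def dec_prod)
  from computable_comp[OF this assms] show ?thesis .
qed

lemma computable_snd [computable_intros]:
  assumes "computable f" shows "computable (\<lambda>x. snd (f x))"
proof -
  have "computable (snd :: 'b \<times> 'c \<Rightarrow> 'c)"
    using partial_recursive.right by (simp add: computable_def dec_prod)
  from computable_comp[OF this assms] show ?thesis .
qed

lemma computable_Pair [computable_intros]:
  assumes "computable f" "computable g" shows "computable (\<lambda>x. (f x, g x))"
  using partial_recursive.pair[OF assms[unfolded computable_def]]
  by (simp add: computable_def enc_Pair)

lemma computable_rec_nat [computable_intros]: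
  assumes f: "computable f"
    and g: "computable (\<lambda>z. g (fst z) (fst (snd z)) (snd (snd z)))"
    and k: "computable k"
  shows "computable (\<lambda>x. rec_nat (f x) (g x) (k x))"
proof -
  \<comment> \<open>Both ingredients always return \<open>Some\<close>, so the recursion on options
    never meets divergence and collapses to an ordinary one.\<close>
  have *: "rec_nat (Some (enc (f (dec a))))
     (\<lambda>y r. Option.bind r (\<lambda>z. Some (enc (g (dec a) y (dec z))))) k
     = Some (enc (rec_nat (f (dec a)) (g (dec a)) k))" for a k
    by (induction k) auto
  have "computable (\<lambda>z. rec_nat (f (fst z)) (g (fst z)) (snd z))"
    using partial_recursive.prim_rec[OF f[unfolded computable_def] g[unfolded computable_def]]
    by (simp add: computable_def dec_prod * case_prod_unfold)
  from computable_comp[OF this computable_Pair[OF computable_id k]]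
  show ?thesis by simp
qed

lemma computable_funpow [computable_intros]:
  fixes g :: "'a::coded \<Rightarrow> 'b::coded \<Rightarrow> 'b"
  assumes "computable k" "computable (\<lambda>z. g (fst z) (snd z))" "computable f"
  shows "computable (\<lambda>x. (g x ^^ k x) (f x))"
proof -
  have *: "(g x ^^ n) y = rec_nat y (\<lambda>_ r. g x r) n" for x y n
    by (induction n) auto
  have "computable (\<lambda>z. g (fst z) (snd (snd z)))"
    using computable_comp[OF assms(2), of "\<lambda>z. (fst z, snd (snd z))"]
    by (simp add: computable_intros)
  then show ?thesis
    unfolding * by (intro computable_intros assms)
qed


subsection \<open>Natural numbers and decidable predicates\<close>

lemma computable_plus_nat [computable_intros]:
  fixes f g :: "_ \<Rightarrow> nat"
  assumes "computable f" "computable g" shows "computable (\<lambda>x. f x + g x)"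
proof -
  have *: "m + n = (Suc ^^ n) m" for m n by (induction n) auto
  show ?thesis unfolding * by (intro computable_intros assms)
qed

lemma computable_mult_nat [computable_intros]:
  fixes f g :: "_ \<Rightarrow> nat"
  assumes "computable f" "computable g" shows "computable (\<lambda>x. f x * g x)"
proof -
  have *: "m * n = rec_nat 0 (\<lambda>_ r. r + m) n" for m n :: nat by (induction n) auto
  \<comment> \<open>Inside the recursion the parameter \<open>f\<close> is applied to a projection
    of the argument tuple, which is why the composition rule for it is supplied as well. The same
    device recurs below.\<close>
  show ?thesis unfolding * by (intro computable_intros assms computable_comp[OF assms(1)])
qed

lemma computable_power_nat [computable_intros]:
  fixes f g :: "_ \<Rightarrow> nat"
  assumes "computable f" "computable g" shows "computable (\<lambda>x. f x ^ g x)"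
proof -
  have *: "m ^ n = rec_nat 1 (\<lambda>_ r. r * m) n" for m n :: nat by (induction n) auto
  show ?thesis unfolding * by (intro computable_intros assms computable_comp[OF assms(1)])
qed

lemma computable_minus_nat [computable_intros]:
  fixes f g :: "_ \<Rightarrow> nat"
  assumes "computable f" "computable g" shows "computable (\<lambda>x. f x - g x)"
proof -
  have pred: "m - 1 = rec_nat 0 (\<lambda>y _. y) m" for m :: nat by (cases m) auto
  have *: "m - n = ((\<lambda>m. rec_nat 0 (\<lambda>y _. y) m) ^^ n) m" for m n :: nat
    by (induction n) (auto simp flip: pred)
  show ?thesis unfolding * by (intro computable_intros assms)
qed

lemma computable_if [computable_intros]:
  assumes "decidable P" "computable f" "computable g"
  shows "computable (\<lambda>x. if P x then f x else g x)"
proof -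
  \<comment> \<open>Branching is a recursion of length 0 or 1, its length being the truth
    value.\<close>
  have *: "(if P x then f x else g x) = rec_nat (g x) (\<lambda>_ _. f x) (of_bool (P x))" for x
    by auto
  show ?thesis unfolding *
    by (intro computable_intros assms computable_comp[OF assms(2)] assms(1)[unfolded decidable_def])
qed

lemma decidable_eq [computable_intros]:
  assumes "computable f" "computable g" shows "decidable (\<lambda>x. f x = g x)"
proof -
  \<comment> \<open>Both truncated differences of the codes vanish exactly when the codes
    agree.\<close>
  have *: "of_bool (f x = g x) = (1::nat) - ((enc (f x) - enc (g x)) + (enc (g x) - enc (f x)))" for x
    using enc_eq_iff[of "f x" "g x"] by (auto simp del: enc_eq_iff)
  show ?thesis unfolding decidable_def * by (intro computable_intros assms)
qed

lemma decidable_le_nat [computable_intros]: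
  fixes f g :: "_ \<Rightarrow> nat"
  assumes "computable f" "computable g" shows "decidable (\<lambda>x. f x \<le> g x)"
proof -
  have *: "f x \<le> g x \<longleftrightarrow> f x - g x = 0" for x by auto
  show ?thesis unfolding * by (intro computable_intros assms)
qed

lemma decidable_not [computable_intros]:
  assumes "decidable P" shows "decidable (\<lambda>x. \<not> P x)"
proof -
  have *: "of_bool (\<not> P x) = (if P x then 0 else 1 :: nat)" for x by auto
  show ?thesis unfolding decidable_def * by (intro computable_intros assms)
qed

lemma decidable_odd [computable_intros]:
  fixes f :: "_ \<Rightarrow> nat"
  assumes "computable f" shows "decidable (\<lambda>x. odd (f x))"
proof -
  have *: "of_bool (odd n) = ((\<lambda>r. 1 - r) ^^ n) (0::nat)" for n :: nat
    by (induction n) (auto split: if_splits)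
  show ?thesis unfolding decidable_def * by (intro computable_intros assms)
qed

lemma computable_half [computable_intros]:
  fixes f :: "_ \<Rightarrow> nat"
  assumes "computable f" shows "computable (\<lambda>x. f x div 2)"
proof -
  have *: "n div 2 = rec_nat 0 (\<lambda>y r. if odd y then Suc r else r) n" for n :: nat
    by (induction n) auto
  show ?thesis unfolding * by (intro computable_intros assms)
qed

lemma decidable_set_decode [computable_intros]:
  assumes "computable f" "computable g" shows "decidable (\<lambda>x. f x \<in> set_decode (g x))"
proof -
  have *: "m div 2 ^ k = ((\<lambda>r. r div 2) ^^ k) m" for k m :: nat
    by (induction k) (simp_all add: div_mult2_eq power_Suc2 del: power_Suc)
  show ?thesis unfolding set_decode_def * mem_Collect_eq by (intro computable_intros assms)
qed


subsection \<open>Integers\<close>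

lemma computable_int [computable_intros]:
  assumes "computable f" shows "computable (\<lambda>x. int (f x))"
proof (rule computable_recode)
  show "computable (\<lambda>x. 2 * f x)" by (intro computable_intros assms)
qed (simp add: enc_int_def enc_nat_def int_encode_def sum_encode_def)

lemma computable_nat [computable_intros]:
  assumes "computable f" shows "computable (\<lambda>x. nat (f x))"
proof -
  have "computable nat"
  proof (rule computable_recode)
    show "computable (\<lambda>n. if odd n then 0 else n div 2 :: nat)" by (intro computable_intros)
  qed (auto simp: enc_int_def enc_nat_def int_encode_def sum_encode_def)
  from computable_comp[OF this assms] show ?thesis .
qed

lemma computable_uminus_int [computable_intros]:
  fixes f :: "_ \<Rightarrow> int"
  assumes "computable f" shows "computable (\<lambda>x. - f x)"
proof -
  have "computable (uminus :: int \<Rightarrow> int)"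
  proof (rule computable_recode)
    \<comment> \<open>A positive \<open>i\<close> has code \<open>2 * i\<close> and
      \<open>- i\<close> has code \<open>2 * i - 1\<close>, so negation swaps neighbours. Truncated
      subtraction fixes the code 0, as it must.\<close>
    show "computable (\<lambda>n. if odd n then n + 1 else n - 1 :: nat)" by (intro computable_intros)
  qed (auto simp: enc_int_def enc_nat_def int_encode_def sum_encode_def nat_eq_iff)
  from computable_comp[OF this assms] show ?thesis .
qed

lemma computable_plus_int [computable_intros]:
  fixes f g :: "_ \<Rightarrow> int"
  assumes "computable f" "computable g" shows "computable (\<lambda>x. f x + g x)"
proof -
  \<comment> \<open>A sum of integers is the difference of two natural numbers; comparing these
    yields the sign.\<close>
  define neg where "neg a b = nat (- a) + nat (- b)" for a b :: int
  define pos where "pos a b = nat a + nat b" for a b :: int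
  have *: "a + b = (if neg a b \<le> pos a b then int (pos a b - neg a b) else - int (neg a b - pos a b))"
    for a b by (auto simp: neg_def pos_def)
  show ?thesis unfolding * unfolding neg_def pos_def by (intro computable_intros assms)
qed

lemma computable_mult_int [computable_intros]:
  fixes f g :: "_ \<Rightarrow> int"
  assumes "computable f" "computable g" shows "computable (\<lambda>x. f x * g x)"
proof -
  have **: "int (nat a) - int (nat (- a)) = a" for a by auto
  have *: "a * b = int (nat a * nat b + nat (- a) * nat (- b)) +
      - int (nat a * nat (- b) + nat (- a) * nat b)" for a b
    by (subst (1) **[of a, symmetric], subst (1) **[of b, symmetric]) (simp add: algebra_simps)
  show ?thesis unfolding * by (intro computable_intros assms)
qed


subsection \<open>Lists\<close>

lemma computable_Cons [computable_intros]:
  assumes "computable f" "computable g" shows "computable (\<lambda>x. f x # g x)"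
proof (rule computable_recode)
  show "computable (\<lambda>x. Suc (enc (f x, g x)))" by (intro computable_intros assms)
qed (simp add: enc_Cons enc_nat_def)

lemma computable_tl [computable_intros]:
  assumes "computable f" shows "computable (\<lambda>x. tl (f x))"
proof -
  \<comment> \<open>This covers the empty list: its code 0 has truncated predecessor 0, whose second
    projection is again 0, the code of \<open>tl []\<close>.\<close>
  have "prod_decode 0 = (0, 0)" by (simp add: prod_decode_def prod_decode_aux.simps)
  then have "enc (tl xs) = snd (prod_decode (enc xs - 1))" for xs :: "'b list"
    by (cases xs) (auto simp: enc_Nil enc_Cons enc_Pair)
  then have *: "enc (tl xs) = snd (dec (enc xs - 1) :: nat \<times> nat)" for xs :: "'b list"
    by (simp add: dec_prod)
  have "computable (tl :: 'b list \<Rightarrow> _)"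
  proof (rule computable_recode)
    show "computable (\<lambda>n. snd (dec (n - 1) :: nat \<times> nat))" by (intro computable_intros)
  qed (simp add: * enc_nat_def)
  from computable_comp[OF this assms] show ?thesis .
qed

lemma computable_hd [computable_intros]:
  assumes "computable f" shows "computable (\<lambda>x. hd (f x))"
proof -
  \<comment> \<open>The value of \<open>hd []\<close> is unspecified but fixed, and every fixed
    value is computable as a constant.\<close>
  define c where "c = hd ([] :: 'b list)"
  have *: "hd xs = (if xs = [] then c else dec (fst (dec (enc xs - 1) :: nat \<times> nat)))"
    for xs :: "'b list"
    by (cases xs) (simp_all add: enc_Cons enc_Pair dec_prod c_def)
  have hd_eq: "hd = (\<lambda>xs :: 'b list. if xs = [] then c else dec (fst (dec (enc xs - 1) :: nat \<times> nat)))"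
    by (rule ext) (rule *)
  have "computable (hd :: 'b list \<Rightarrow> _)"
    unfolding hd_eq by (intro computable_intros)
  from computable_comp[OF this assms] show ?thesis .
qed

text \<open>A list is never longer than its code, and iterating past the end of the list is harmless;
  so the code itself serves as the number of rounds.\<close>

lemma computable_fold [computable_intros]:
  assumes l: "computable l"
    and f: "computable (\<lambda>z. f (fst z) (fst (snd z)) (snd (snd z)))"
    and a: "computable a"
  shows "computable (\<lambda>x. fold (f x) (l x) (a x))"
proof -
  define step where "step h z = (if fst z = [] then z else (tl (fst z), h (hd (fst z)) (snd z)))"
    for h :: "'b \<Rightarrow> 'c \<Rightarrow> 'c" and z
  have "snd ((step h ^^ n) (xs, c)) = fold h xs c" if "length xs \<le> n" for h n xs c
    using that
  proof (induction n arbitrary: xs c)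
    case (Suc n)
    show ?case
    proof (cases xs)
      case Nil
      then show ?thesis using Suc.IH[of "[]"] by (simp add: funpow_Suc_right step_def del: funpow.simps)
    next
      case (Cons y ys)
      then show ?thesis using Suc by (simp add: funpow_Suc_right step_def del: funpow.simps)
    qed
  qed simp
  then have *: "fold h xs c = snd ((step h ^^ enc xs) (xs, c))" for h xs c
    using enc_length by metis
  have f': "computable (\<lambda>z. f (fst z) (hd (fst (snd z))) (snd (snd z)))"
    using computable_comp[OF f, of "\<lambda>z. (fst z, hd (fst (snd z)), snd (snd z))"]
    by (simp add: computable_intros)
  show ?thesis unfolding * unfolding step_def by (intro computable_intros f' a l)
qed

lemma computable_rev [computable_intros]:
  assumes "computable l" shows "computable (\<lambda>x. rev (l x))"
  unfolding rev_conv_fold by (intro computable_intros assms)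

lemma computable_foldr [computable_intros]:
  assumes "computable (\<lambda>z. f (fst z) (fst (snd z)) (snd (snd z)))" "computable l" "computable a"
  shows "computable (\<lambda>x. foldr (f x) (l x) (a x))"
  unfolding foldr_conv_fold by (intro computable_intros assms)

lemma computable_append [computable_intros]:
  assumes "computable f" "computable g" shows "computable (\<lambda>x. f x @ g x)"
proof -
  have *: "xs @ ys = foldr Cons xs ys" for xs ys :: "'b list"
    by (induction xs) auto
  show ?thesis unfolding * by (intro computable_intros assms)
qed

text \<open>Brings a function of parameter and element into the shape required of a fold, where an
  accumulator is present too.\<close>

lemma computable_foldr_element:
  fixes f :: "'a::coded \<Rightarrow> 'b::coded \<Rightarrow> 'd::coded"
  assumes "computable (\<lambda>z. f (fst z) (snd z))"
  shows "computable (\<lambda>z :: 'a \<times> 'b \<times> 'c::coded. f (fst z) (fst (snd z)))"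
  using computable_comp[OF assms, of "\<lambda>z. (fst z, fst (snd z))"] by (simp add: computable_intros)

lemma computable_map [computable_intros]:
  assumes "computable (\<lambda>z. f (fst z) (snd z))" "computable l"
  shows "computable (\<lambda>x. map (f x) (l x))"
proof -
  have *: "map h xs = foldr (\<lambda>y r. h y # r) xs []" for h and xs :: "'b list"
    by (induction xs) auto
  show ?thesis unfolding *
    by (intro computable_intros assms computable_foldr_element[OF assms(1)])
qed

lemma computable_concat [computable_intros]:
  assumes "computable l" shows "computable (\<lambda>x. concat (l x))"
  unfolding concat_conv_foldr by (intro computable_intros assms)

lemma computable_filter [computable_intros]:
  assumes "decidable (\<lambda>z. P (fst z) (snd z))" "computable l"
  shows "computable (\<lambda>x. filter (P x) (l x))"
proof -
  have *: "filter h xs = foldr (\<lambda>y r. if h y then y # r else r) xs []" for h and xs :: "'b list"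
    by (induction xs) auto
  show ?thesis unfolding *
    by (intro computable_intros assms computable_foldr_element[OF assms(1)[unfolded decidable_def], folded decidable_def])
qed

lemma decidable_ball_list [computable_intros]:
  assumes "decidable (\<lambda>z. P (fst z) (snd z))" "computable l"
  shows "decidable (\<lambda>x. \<forall>y \<in> set (l x). P x y)"
proof -
  have *: "(\<forall>y \<in> set (l x). P x y) \<longleftrightarrow> filter (\<lambda>y. \<not> P x y) (l x) = []" for x
    by (auto simp: filter_empty_conv)
  show ?thesis unfolding * by (intro computable_intros assms)
qed

lemma decidable_member_list [computable_intros]:
  assumes "computable f" "computable l"
  shows "decidable (\<lambda>x. f x \<in> set (l x))"
proof -
  have *: "f x \<in> set (l x) \<longleftrightarrow> \<not> (\<forall>y \<in> set (l x). \<not> y = f x)" for x by auto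
  show ?thesis unfolding * by (intro computable_intros assms computable_comp[OF assms(1)])
qed

lemma computable_sum_list_nat [computable_intros]:
  fixes l :: "_ \<Rightarrow> nat list"
  assumes "computable l" shows "computable (\<lambda>x. sum_list (l x))"
  unfolding sum_list.eq_foldr by (intro computable_intros assms)

lemma computable_sum_list_int [computable_intros]:
  fixes l :: "_ \<Rightarrow> int list"
  assumes "computable l" shows "computable (\<lambda>x. sum_list (l x))"
  unfolding sum_list.eq_foldr by (intro computable_intros assms)

lemma computable_upt [computable_intros]:
  assumes "computable k" shows "computable (\<lambda>x. [0..<k x])"
proof -
  have *: "[0..<n] = rec_nat [] (\<lambda>i r. r @ [i]) n" for n by (induction n) auto
  show ?thesis unfolding * by (intro computable_intros assms)
qed

lemma computable_drop [computable_intros]: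
  assumes "computable k" "computable l" shows "computable (\<lambda>x. drop (k x) (l x))"
proof -
  have *: "drop n xs = (tl ^^ n) xs" for n and xs :: "'b list"
    by (induction n) (simp_all add: drop_Suc flip: tl_drop)
  show ?thesis unfolding * by (intro computable_intros assms)
qed

subsection \<open>Finite sets of natural numbers and unbounded search\<close>

lemma computable_set_encode [computable_intros]:
  assumes "computable l" shows "computable (\<lambda>x. set_encode (set (l x)))"
proof -
  \<comment> \<open>The set code is a sum of powers of two over distinct members, so repeated
    entries have to be removed before summing.\<close>
  define ins where "ins y r = (if y \<in> set r then r else y # r)" for y :: nat and r
  have "set (foldr ins xs []) = set xs \<and> distinct (foldr ins xs [])" for xs
    by (induction xs) (auto simp: ins_def)
  then have *: "set_encode (set xs) = sum_list (map (\<lambda>y. 2 ^ y) (foldr ins xs []))" for xs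
    by (metis set_encode_def sum_list_distinct_conv_sum_set)
  show ?thesis unfolding * unfolding ins_def by (intro computable_intros assms)
qed

definition elements :: "nat \<Rightarrow> nat list" where
  "elements n = filter (\<lambda>k. k \<in> set_decode n) [0..<n]"

text \<open>A member \<open>k\<close> of the decoded set is a binary digit of \<open>n\<close>, so
  \<open>2 ^ k \<le> n\<close> and thus \<open>k < n\<close>: filtering the range below
  \<open>n\<close> loses nothing.\<close>

lemma set_elements [simp]: "set (elements n) = set_decode n"
proof -
  have "k < n" if "k \<in> set_decode n" for k
  proof -
    have "2 ^ k \<le> n"
      using that by (auto simp: set_decode_def intro: ccontr)
    with less_exp[of k] show ?thesis by linarith
  qed
  then show ?thesis by (auto simp: elements_def)
qed

lemma computable_elements [computable_intros]:
  assumes "computable f" shows "computable (\<lambda>x. elements (f x))"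
  unfolding elements_def by (intro computable_intros computable_comp[OF assms] assms)

text \<open>\<open>minimise\<close> looks for a zero, so it is applied to the truth value of the
  negated predicate; the witness is then paired with the argument and handed to \<open>h\<close>.
  The conclusion does not say which witness is found, since later only its property matters.\<close>

lemma partial_recursive_search:
  fixes P :: "'a::coded \<Rightarrow> nat \<Rightarrow> bool" and h :: "'a \<Rightarrow> nat \<Rightarrow> 'b::coded"
  assumes P: "decidable (\<lambda>z. P (fst z) (snd z))" and h: "computable (\<lambda>z. h (fst z) (snd z))"
  obtains F where "partial_recursive F"
    "\<And>x. \<exists>n. P x n \<Longrightarrow> \<exists>n. P x n \<and> F (enc x) = Some (enc (h x n))"
proof
  define notP where "notP n = (of_bool (\<not> P (dec (fst (prod_decode n))) (snd (prod_decode n))) :: nat)" for n :: nat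
  have notP: "partial_recursive (\<lambda>n. Some (notP n))"
    using decidable_not[OF P] by (simp add: decidable_def computable_def enc_nat_def notP_def dec_prod)
  have h': "partial_recursive (\<lambda>n. Some (enc (h (dec (fst (prod_decode n))) (snd (prod_decode n)))))"
    using h by (simp add: computable_def dec_prod)
  have id: "partial_recursive Some"
    using computable_id[where 'a = nat] by (simp add: computable_def enc_nat_def)
  define F where "F = (\<lambda>n. Option.bind (Option.bind (Some n) (\<lambda>a. Option.bind
     (if \<exists>n. Some (notP (prod_encode (a, n))) = Some 0 \<and>
                  (\<forall>m<n. Some (notP (prod_encode (a, m))) \<noteq> None)
           then Some (LEAST n. Some (notP (prod_encode (a, n))) = Some 0)
           else None) (\<lambda>b. Some (prod_encode (a, b)))))
     (\<lambda>n. Some (enc (h (dec (fst (prod_decode n))) (snd (prod_decode n))))))"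
  show "partial_recursive F" unfolding F_def
    using partial_recursive.comp[OF h' partial_recursive.pair[OF id partial_recursive.minimise[OF notP]]]
    by simp
  show "\<exists>n. P x n \<and> F (enc x) = Some (enc (h x n))" if ex: "\<exists>n. P x n" for x
    using ex LeastI_ex[OF ex] by (auto simp: F_def notP_def)
qed

section \<open>Runs\<close>

lemma reach_refl: "c \<in> configs V \<Longrightarrow> reach V c c"
  unfolding reach_def by (metis run.simps(1))

lemma reach_Cons:
  assumes "(s, x) \<in> configs V" "(s, A, b, r) \<in> transitions V" "reach V (r, A *\<^sub>v x + b) c"
  shows "reach V (s, x) c"
proof -
  obtain w where "run V w (r, A *\<^sub>v x + b) c" using assms(3) by (auto simp: reach_def)
  with assms have "run V ((s, A, b, r) # w) (s, x) c"
    by (auto simp: step_def intro!: exI[of _ r])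
  then show ?thesis unfolding reach_def by blast
qed

lemma run_append: "run V w c c' \<Longrightarrow> run V w' c' c'' \<Longrightarrow> run V (w @ w') c c''"
  by (induction w arbitrary: c) auto

lemma reach_trans: "reach V c c' \<Longrightarrow> reach V c' c'' \<Longrightarrow> reach V c c''"
  unfolding reach_def by (metis run_append)

lemma reach_induct [consumes 1, case_names base step]:
  assumes "reach V c c'" "P c"
    and "\<And>s x A b r. P (s, x) \<Longrightarrow> (s, x) \<in> configs V \<Longrightarrow> (s, A, b, r) \<in> transitions V
           \<Longrightarrow> P (r, A *\<^sub>v x + b)"
  shows "P c'"
proof -
  have "P c'" if "run V w c c'" "P c" for w c
    using that
  proof (induction w arbitrary: c)
    case (Cons t w)
    then obtain e A b where e: "run V w e c'" "t = (fst c, A, b, fst e)" "snd e = A *\<^sub>v snd c + b"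
      and c: "c \<in> configs V" "t \<in> transitions V"
      by (auto simp: step_def)
    have "P (fst e, A *\<^sub>v snd c + b)"
      using assms(3)[of "fst c" "snd c" A b "fst e"] e c Cons.prems(2) by simp
    then have "P e" using e(3) by (metis prod.collapse)
    with Cons.IH e(1) show ?case by blast
  qed simp
  with assms show ?thesis unfolding reach_def by blast
qed


section \<open>Running backwards from the target\<close>

text \<open>\<open>backward V q s M c\<close> holds when some path from \<open>s\<close> to \<open>q\<close> has the composed effect
  \<open>u \<mapsto> M u + c\<close>. Reading the path from its end turns \<open>c\<close> into a running sum, because every
  earlier transition contributes its translation multiplied by the matrix read so far.\<close>

inductive backward :: "'q vass \<Rightarrow> 'q \<Rightarrow> 'q \<Rightarrow> int mat \<Rightarrow> int vec \<Rightarrow> bool" for V q where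
  start: "backward V q q (1\<^sub>m (dimension V)) (0\<^sub>v (dimension V))"
| extend: "backward V q s M c \<Longrightarrow> (r, A, b, s) \<in> transitions V \<Longrightarrow>
    backward V q r (M * A) (c + M *\<^sub>v b)"

text \<open>The translation is forgotten because it is unbounded; what remains lies in the product
  of the states and the monoid and is therefore finite under the finite-monoid property.\<close>

definition backward_pairs :: "'q vass \<Rightarrow> 'q \<Rightarrow> ('q \<times> int mat) set" where
  "backward_pairs V q = {(s, M). \<exists>c. backward V q s M c}"

lemma backward_pairs_start: "(q, 1\<^sub>m (dimension V)) \<in> backward_pairs V q"
  by (auto simp: backward_pairs_def intro: backward.start)

lemma backward_pairs_extend:
  "(s, M) \<in> backward_pairs V q \<Longrightarrow> (r, A, b, s) \<in> transitions V \<Longrightarrow>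
    (r, M * A) \<in> backward_pairs V q"
  by (auto simp: backward_pairs_def intro: backward.extend)

lemma backward_pairs_induct [consumes 1, case_names start extend]:
  assumes "(s, M) \<in> backward_pairs V q"
    and "P q (1\<^sub>m (dimension V))"
    and "\<And>s M r A b. (s, M) \<in> backward_pairs V q \<Longrightarrow> P s M \<Longrightarrow> (r, A, b, s) \<in> transitions V
           \<Longrightarrow> P r (M * A)"
  shows "P s M"
proof -
  obtain c where "backward V q s M c" using assms(1) by (auto simp: backward_pairs_def)
  then show ?thesis
  proof induction
    case (extend s M c r A b)
    then show ?case using assms(3)[of s M r A b] by (auto simp: backward_pairs_def)
  qed (rule assms(2))
qed

lemma mat_monoid_carrier:
  assumes "affine_zvass V" "M \<in> mat_monoid V"
  shows "M \<in> carrier_mat (dimension V) (dimension V)"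
  using assms(2) by induction (use assms(1) in \<open>auto simp: affine_zvass_def\<close>)

lemma backward_closed:
  assumes "affine_zvass V" "q \<in> states V" "backward V q s M c"
  shows "s \<in> states V" "M \<in> mat_monoid V" "c \<in> carrier_vec (dimension V)"
proof -
  have "s \<in> states V \<and> M \<in> mat_monoid V \<and> c \<in> carrier_vec (dimension V)"
    using assms(3)
  proof induction
    case (extend s M c r A b)
    moreover have "M *\<^sub>v b \<in> carrier_vec (dimension V)"
      using mat_monoid_carrier[OF assms(1)] extend assms(1)
      by (auto simp: affine_zvass_def intro!: mult_mat_vec_carrier)
    ultimately show ?case
      using assms(1) by (auto simp: affine_zvass_def intro: mat_monoid.intros)
  qed (use assms in \<open>auto intro: mat_monoid.one\<close>)
  then show "s \<in> states V" "M \<in> mat_monoid V" "c \<in> carrier_vec (dimension V)" by auto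
qed

lemma backward_pairs_subset:
  assumes "affine_zvass V" "q \<in> states V"
  shows "backward_pairs V q \<subseteq> states V \<times> mat_monoid V"
  using backward_closed[OF assms] by (auto simp: backward_pairs_def)

text \<open>A run is built by prepending transitions, and so is a derivation of
  \<open>backward\<close>; both directions are inductions that add one transition at the
  front.\<close>

lemma reach_iff_backward:
  assumes V: "affine_zvass V" "q \<in> states V" and r: "r \<in> states V"
    and u: "u \<in> carrier_vec (dimension V)"
  shows "reach V (r, u) (q, v) \<longleftrightarrow> (\<exists>M c. backward V q r M c \<and> v = M *\<^sub>v u + c)"
proof
  let ?d = "dimension V"
  note carriers = backward_closed[OF V] mat_monoid_carrier[OF V(1)]
  \<comment> \<open>The effect after a transition, rewritten as an effect before it. This identity
    dictates the update of \<open>M\<close> and \<open>c\<close> in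
    \<open>backward.extend\<close>.\<close>
  have affine: "M *\<^sub>v (A *\<^sub>v u + b) + c = (M * A) *\<^sub>v u + (c + M *\<^sub>v b)"
    if "backward V q s M c" "(r, A, b, s) \<in> transitions V" "u \<in> carrier_vec ?d" for r A b s M c u
  proof -
    have A: "A \<in> carrier_mat ?d ?d" "b \<in> carrier_vec ?d"
      using that V(1) by (auto simp: affine_zvass_def)
    have M: "M \<in> carrier_mat ?d ?d" "c \<in> carrier_vec ?d"
      using carriers that(1) by blast+
    have "M *\<^sub>v (A *\<^sub>v u + b) = (M * A) *\<^sub>v u + M *\<^sub>v b"
      using A M that(3)
      by (simp add: mult_add_distrib_mat_vec[OF M(1)] assoc_mult_mat_vec[OF M(1) A(1)])
    then show ?thesis
      using A M that(3) by (simp add: assoc_add_vec[of _ ?d] comm_add_vec[of c ?d])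
  qed
  show "\<exists>M c. backward V q r M c \<and> v = M *\<^sub>v u + c" if "reach V (r, u) (q, v)"
  proof -
    have "\<exists>M c. backward V q r M c \<and> v = M *\<^sub>v u + c"
      if "run V w (r, u) (q, v)" "u \<in> carrier_vec ?d" for w r u
      using that
    proof (induction w arbitrary: r u)
      case Nil
      then show ?case
        using backward.start[of V q]
        by (intro exI[of _ "1\<^sub>m ?d"] exI[of _ "0\<^sub>v ?d"]) (auto simp: configs_def)
    next
      case (Cons t w)
      then obtain s A b where t: "t = (r, A, b, s)" "t \<in> transitions V"
        and w: "run V w (s, A *\<^sub>v u + b) (q, v)"
        by (auto simp: step_def)
      have "A *\<^sub>v u + b \<in> carrier_vec ?d"
        using V(1) t Cons.prems(2) by (auto simp: affine_zvass_def)
      from Cons.IH[OF w this] obtain M c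
        where "backward V q s M c" "v = M *\<^sub>v (A *\<^sub>v u + b) + c" by blast
      then show ?case
        using affine t Cons.prems(2) backward.extend[of V q s M c r A b] by metis
    qed
    with that u show ?thesis by (auto simp: reach_def)
  qed
  show "reach V (r, u) (q, v)" if "\<exists>M c. backward V q r M c \<and> v = M *\<^sub>v u + c"
  proof -
    have "reach V (r, u) (q, M *\<^sub>v u + c)" if "backward V q r M c" "u \<in> carrier_vec ?d" for r M c u
      using that
    proof (induction arbitrary: u)
      case start
      then show ?case using V by (auto simp: configs_def intro!: reach_refl)
    next
      case (extend s M c r A b)
      have "A *\<^sub>v u + b \<in> carrier_vec ?d" "(r, u) \<in> configs V"
        using V(1) extend by (auto simp: affine_zvass_def configs_def)
      with extend show ?case
        using affine[OF extend(1,2)] by (metis reach_Cons)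
    qed
    with that u show ?thesis by blast
  qed
qed


section \<open>Norms\<close>

lemma norm_vec_leI: "0 \<le> K \<Longrightarrow> (\<And>i. i < dim_vec x \<Longrightarrow> \<bar>x $ i\<bar> \<le> K) \<Longrightarrow> norm_vec x \<le> K"
  unfolding norm_vec_def by (subst Max_le_iff) auto

lemma norm_vec_ge: "i < dim_vec x \<Longrightarrow> \<bar>x $ i\<bar> \<le> norm_vec x"
  unfolding norm_vec_def by (rule Max_ge) auto

lemma norm_vec_nonneg: "0 \<le> norm_vec x"
  unfolding norm_vec_def by (rule Max_ge) auto

lemma norm_vec_append_leI:
  assumes "norm_vec v \<le> K" "norm_vec w \<le> K"
  shows "norm_vec (v @\<^sub>v w) \<le> K"
proof (rule norm_vec_leI)
  show "0 \<le> K" using norm_vec_nonneg[of v] assms(1) by simp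
  fix i assume "i < dim_vec (v @\<^sub>v w)"
  then show "\<bar>(v @\<^sub>v w) $ i\<bar> \<le> K"
    using assms norm_vec_ge[of i v] norm_vec_ge[of "i - dim_vec v" w]
    by (cases "i < dim_vec v") (force+)
qed

lemma norm_mat_leI: "0 \<le> K \<Longrightarrow> (\<And>i j. i < dim_row A \<Longrightarrow> j < dim_col A \<Longrightarrow> \<bar>A $$ (i, j)\<bar> \<le> K)
    \<Longrightarrow> norm_mat A \<le> K"
  unfolding norm_mat_def by (subst Max_le_iff) (auto simp: cols_def intro!: norm_vec_leI)

lemma norm_mat_ge:
  assumes "i < dim_row A" "j < dim_col A"
  shows "\<bar>A $$ (i, j)\<bar> \<le> norm_mat A"
proof -
  have "\<bar>A $$ (i, j)\<bar> \<le> norm_vec (col A j)"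
    using norm_vec_ge[of i "col A j"] assms by simp
  also have "\<dots> \<le> norm_mat A"
    unfolding norm_mat_def using assms by (intro Max_ge) (auto simp: cols_def)
  finally show ?thesis .
qed

lemma norm_mats_ge: "finite G \<Longrightarrow> A \<in> G \<Longrightarrow> norm_mat A \<le> norm_mats G"
  unfolding norm_mats_def by (rule Max_ge) auto

lemma norm_mat_nonneg: "0 \<le> norm_mat A"
  unfolding norm_mat_def by (rule Max_ge) auto

lemma norm_mats_nonneg: "finite G \<Longrightarrow> 0 \<le> norm_mats G"
  unfolding norm_mats_def by (rule Max_ge) auto

lemma finite_transition_norms:
  "finite T \<Longrightarrow> finite (insert 0 (\<Union>(p, A, b, q) \<in> T. {norm_vec b, norm_mat A}))"
  by auto

lemma norm_trans_ge: "finite T \<Longrightarrow> (p, A, b, q) \<in> T \<Longrightarrow> norm_vec b \<le> norm_trans T"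
  unfolding norm_trans_def by (rule Max_ge) (auto intro!: bexI[of _ "(p, A, b, q)"])

lemma norm_trans_nonneg: "finite T \<Longrightarrow> 0 \<le> norm_trans T"
  unfolding norm_trans_def by (rule Max_ge) auto

lemma norm_trans_leI:
  assumes "finite T" "0 \<le> K"
    "\<And>p A b q. (p, A, b, q) \<in> T \<Longrightarrow> norm_vec b \<le> K \<and> norm_mat A \<le> K"
  shows "norm_trans T \<le> K"
  unfolding norm_trans_def using assms(2,3)
  by (subst Max_le_iff[OF finite_transition_norms[OF assms(1)]]) auto

text \<open>Every coordinate is a sum of \<open>d\<close> products; this is the origin of the factor
  \<open>d\<close> in the general norm bound.\<close>

lemma norm_mult_mat_vec_le:
  assumes "A \<in> carrier_mat d d" "b \<in> carrier_vec d"
  shows "norm_vec (A *\<^sub>v b) \<le> int d * norm_mat A * norm_vec b"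
proof -
  note nonneg = norm_mat_nonneg[of A] norm_vec_nonneg[of b]
  show ?thesis
  proof (rule norm_vec_leI)
    fix i assume i: "i < dim_vec (A *\<^sub>v b)"
    then have "\<bar>(A *\<^sub>v b) $ i\<bar> = \<bar>\<Sum>j = 0..<d. A $$ (i, j) * b $ j\<bar>"
      using assms by (simp add: scalar_prod_def)
    also have "\<dots> \<le> (\<Sum>j = 0..<d. \<bar>A $$ (i, j) * b $ j\<bar>)" by (rule sum_abs)
    also have "\<dots> \<le> (\<Sum>j = 0..<d. norm_mat A * norm_vec b)"
      using i assms nonneg
      by (intro sum_mono) (auto simp: abs_mult intro!: mult_mono norm_mat_ge norm_vec_ge)
    finally show "\<bar>(A *\<^sub>v b) $ i\<bar> \<le> int d * norm_mat A * norm_vec b" by simp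
  qed (use nonneg in simp)
qed


section \<open>The simulating integer VASS\<close>

definition mat_list :: "int mat \<Rightarrow> int list list" where
  "mat_list M = map list_of_vec (rows M)"

text \<open>The control-states are numbers because the machine is the output of an algorithm. The
  leading tags 0, 1, 2 keep the three kinds of states apart, and matrices enter as lists of rows,
  for which codes are available.\<close>

definition node :: "('q \<Rightarrow> nat) \<Rightarrow> 'q \<Rightarrow> int mat \<Rightarrow> nat" where
  "node \<nu> s M = enc (0::nat, \<nu> s, mat_list M)"

definition transfer :: "int mat \<Rightarrow> nat" where
  "transfer M = enc (1::nat, 0::nat, mat_list M)"

definition final :: nat where
  "final = enc (2::nat, 0::nat, [] :: int list list)"

text \<open>Both signs occur because the coordinates of \<open>u\<close> may have either sign; each
  matrix thus gets at most \<open>2 * d\<close> loops.\<close>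

definition signed_units :: "nat \<Rightarrow> int vec set" where
  "signed_units d = {\<sigma> \<cdot>\<^sub>v unit_vec d i | \<sigma> i. \<sigma> \<in> {1, -1} \<and> i < d}"

text \<open>The control-states \<^term>\<open>node \<nu> s M\<close> guess a path backwards from \<open>q\<close>, adding its effect
  to the second half of the counters. Once the start state \<open>p\<close> is met, the loops at
  \<^term>\<open>transfer M\<close> trade the initial vector \<open>u\<close> in the first half for \<open>M u\<close> in the second.\<close>

definition sim_transitions :: "('q \<Rightarrow> nat) \<Rightarrow> 'q vass \<Rightarrow> 'q \<Rightarrow> 'q \<Rightarrow> nat transition set" where
  "sim_transitions \<nu> V p q = (let d = dimension V; R = backward_pairs V q; I = 1\<^sub>m (2 * d) in
     {(node \<nu> s M, I, 0\<^sub>v d @\<^sub>v M *\<^sub>v b, node \<nu> r (M * A)) | s M r A b.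
        (s, M) \<in> R \<and> (r, A, b, s) \<in> transitions V} \<union>
     {(node \<nu> p M, I, 0\<^sub>v d @\<^sub>v 0\<^sub>v d, transfer M) | M. (p, M) \<in> R} \<union>
     {(transfer M, I, - x @\<^sub>v M *\<^sub>v x, transfer M) | M x. (p, M) \<in> R \<and> x \<in> signed_units d} \<union>
     {(transfer M, I, 0\<^sub>v d @\<^sub>v 0\<^sub>v d, final) | M. (p, M) \<in> R})"

definition sim_states :: "('q \<Rightarrow> nat) \<Rightarrow> 'q vass \<Rightarrow> 'q \<Rightarrow> 'q \<Rightarrow> nat set" where
  "sim_states \<nu> V p q =
     {node \<nu> s M | s M. (s, M) \<in> backward_pairs V q} \<union>
     {transfer M | M. (p, M) \<in> backward_pairs V q} \<union> {final}"

definition sim :: "('q \<Rightarrow> nat) \<Rightarrow> 'q vass \<Rightarrow> 'q \<Rightarrow> 'q \<Rightarrow> nat vass" where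
  "sim \<nu> V p q = \<lparr>dimension = 2 * dimension V, states = sim_states \<nu> V p q,
     transitions = sim_transitions \<nu> V p q\<rparr>"

text \<open>The rows determine all entries, but an empty list of rows does not show the number of
  columns; the common carrier supplies the dimensions.\<close>

lemma mat_list_inj:
  assumes "mat_list M = mat_list N" "M \<in> carrier_mat d d" "N \<in> carrier_mat d d"
  shows "M = N"
proof (rule eq_matI)
  fix i j assume ij: "i < dim_row N" "j < dim_col N"
  have "M $$ (i, j) = mat_list M ! i ! j" "N $$ (i, j) = mat_list N ! i ! j"
    using ij assms(2,3) by (simp_all add: mat_list_def)
  then show "M $$ (i, j) = N $$ (i, j)" using assms(1) by simp
qed (use assms in auto)

lemma node_transfer_final_distinct [simp]:
  "node \<nu> s M \<noteq> transfer N" "node \<nu> s M \<noteq> final" "transfer N \<noteq> final"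
  "transfer N \<noteq> node \<nu> s M" "final \<noteq> node \<nu> s M" "final \<noteq> transfer N"
  by (simp_all add: node_def transfer_def final_def)

lemma signed_units_carrier: "x \<in> signed_units d \<Longrightarrow> x \<in> carrier_vec d"
  by (auto simp: signed_units_def)

lemma signed_unit_abs_le: "x \<in> signed_units d \<Longrightarrow> \<bar>x $ i\<bar> \<le> 1 \<or> \<not> i < d"
  by (auto simp: signed_units_def unit_vec_def split: if_splits)

text \<open>Up to sign, \<open>M *\<^sub>v x\<close> is a column of \<open>M\<close>, so the loops
  cost no factor \<open>d\<close>.\<close>

lemma mult_signed_unit_abs_le:
  assumes "x \<in> signed_units d" "M \<in> carrier_mat d d" "i < d"
  shows "\<bar>(M *\<^sub>v x) $ i\<bar> \<le> norm_mat M"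
proof -
  obtain \<sigma> j where x: "x = \<sigma> \<cdot>\<^sub>v unit_vec d j" "\<sigma> \<in> {1, -1}" "j < d"
    using assms(1) by (auto simp: signed_units_def)
  have "(M *\<^sub>v x) $ i = \<sigma> * M $$ (i, j)"
    using assms x by (simp add: mult_mat_vec)
  then show ?thesis
    using norm_mat_ge[of i M j] assms x by (auto simp: abs_mult)
qed

lemma mult_mat_zero_vec: "(M :: int mat) \<in> carrier_mat n m \<Longrightarrow> M *\<^sub>v 0\<^sub>v m = 0\<^sub>v n"
  by (intro eq_vecI) auto

section \<open>Distinctness of the state names and finiteness of the reachable pairs\<close>

locale simulation =
  fixes \<nu> :: "'q \<Rightarrow> nat" and V :: "'q vass" and p q :: 'q
  assumes affine: "affine_zvass V" and fin_monoid: "finite (mat_monoid V)"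
    and p: "p \<in> states V" and q: "q \<in> states V" and inj: "inj_on \<nu> (states V)"
begin

abbreviation "d \<equiv> dimension V"
abbreviation "R \<equiv> backward_pairs V q"

lemma transitionsD:
  assumes "(r, A, b, s) \<in> transitions V"
  shows "r \<in> states V" "A \<in> carrier_mat d d" "b \<in> carrier_vec d" "s \<in> states V"
  using assms affine by (auto simp: affine_zvass_def)

lemma finite_states: "finite (states V)" and finite_transitions: "finite (transitions V)"
  using affine by (auto simp: affine_zvass_def)

lemma R_D:
  assumes "(s, M) \<in> R"
  shows "s \<in> states V" "M \<in> mat_monoid V" "M \<in> carrier_mat d d"
  using assms backward_pairs_subset[OF affine q] mat_monoid_carrier[OF affine] by blast+

text \<open>The names are injective only on the states of \<open>V\<close>, and lists of rows only
  on matrices of one dimension; membership in \<open>R\<close> guarantees both.\<close>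

lemma node_eq_iff:
  assumes "(s, M) \<in> R" "(s', M') \<in> R"
  shows "node \<nu> s M = node \<nu> s' M' \<longleftrightarrow> s = s' \<and> M = M'"
  using inj_on_eq_iff[OF inj R_D(1)[OF assms(1)] R_D(1)[OF assms(2)]]
    mat_list_inj[OF _ R_D(3)[OF assms(1)] R_D(3)[OF assms(2)]]
  by (auto simp: node_def)

lemma transfer_eq_iff:
  assumes "(s, M) \<in> R" "(s', M') \<in> R"
  shows "transfer M = transfer M' \<longleftrightarrow> M = M'"
  using mat_list_inj[OF _ R_D(3)[OF assms(1)] R_D(3)[OF assms(2)]] by (auto simp: transfer_def)

lemma sim_simps [simp]:
  "dimension (sim \<nu> V p q) = 2 * d" "states (sim \<nu> V p q) = sim_states \<nu> V p q"
  "transitions (sim \<nu> V p q) = sim_transitions \<nu> V p q"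
  by (simp_all add: sim_def)

lemma sim_transitions_cases [consumes 1, case_names walk enter move exit]:
  assumes "(s', A', b', r') \<in> sim_transitions \<nu> V p q"
  obtains s M r A b where "s' = node \<nu> s M" "A' = 1\<^sub>m (2 * d)" "b' = 0\<^sub>v d @\<^sub>v M *\<^sub>v b"
      "r' = node \<nu> r (M * A)" "(s, M) \<in> R" "(r, A, b, s) \<in> transitions V"
  | M where "s' = node \<nu> p M" "A' = 1\<^sub>m (2 * d)" "b' = 0\<^sub>v d @\<^sub>v 0\<^sub>v d" "r' = transfer M" "(p, M) \<in> R"
  | M x where "s' = transfer M" "A' = 1\<^sub>m (2 * d)" "b' = - x @\<^sub>v M *\<^sub>v x" "r' = transfer M"
      "(p, M) \<in> R" "x \<in> signed_units d"
  | M where "s' = transfer M" "A' = 1\<^sub>m (2 * d)" "b' = 0\<^sub>v d @\<^sub>v 0\<^sub>v d" "r' = final" "(p, M) \<in> R"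
  using assms unfolding sim_transitions_def Let_def by blast

lemma finite_R: "finite R"
  using backward_pairs_subset[OF affine q] finite_states fin_monoid
  by (blast intro: finite_subset[OF _ finite_cartesian_product])

lemma sim_states_image: "sim_states \<nu> V p q =
   (\<lambda>(s, M). node \<nu> s M) ` R \<union> transfer ` {M. (p, M) \<in> R} \<union> {final}"
  by (auto simp: sim_states_def)

lemma start_fibre_subset: "{M. (p, M) \<in> R} \<subseteq> mat_monoid V"
  using R_D by blast

lemma finite_start_fibre: "finite {M. (p, M) \<in> R}"
  using start_fibre_subset fin_monoid by (rule finite_subset)

section \<open>Counting control-states and transitions\<close>

lemma card_monoid_pos: "1 \<le> card (mat_monoid V)"
  using fin_monoid mat_monoid.one[of V] by (metis card_0_eq empty_iff less_one not_le)

lemma card_states_pos: "1 \<le> card (states V)"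
  using finite_states p by (metis card_0_eq empty_iff less_one not_le)

text \<open>Nodes, transfer states and the final state contribute at most \<open>|Q| * |M|\<close>,
  \<open>|M|\<close> and 1. Neither set is empty, so each of the three is at most
  \<open>|Q| * |M|\<close>, which explains the 3.\<close>

lemma card_sim_states: "card (sim_states \<nu> V p q) \<le> 3 * card (mat_monoid V) * card (states V)"
proof -
  have "card R \<le> card (states V \<times> mat_monoid V)"
    using backward_pairs_subset[OF affine q] finite_states fin_monoid by (intro card_mono) auto
  then have "card ((\<lambda>(s, M). node \<nu> s M) ` R) \<le> card (states V) * card (mat_monoid V)"
    using card_image_le[OF finite_R, of "\<lambda>(s, M). node \<nu> s M"] by (simp add: card_cartesian_product)
  moreover have "card (transfer ` {M. (p, M) \<in> R}) \<le> card (mat_monoid V)"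
    using card_image_le[OF finite_start_fibre, of transfer] card_mono[OF fin_monoid start_fibre_subset]
    by simp
  ultimately have "card (sim_states \<nu> V p q) \<le>
      card (states V) * card (mat_monoid V) + card (mat_monoid V) + 1"
    unfolding sim_states_image
    by (intro order_trans[OF card_Un_le] add_mono order_trans[OF card_Un_le]) auto
  moreover have "card (mat_monoid V) \<le> card (states V) * card (mat_monoid V)"
    using card_states_pos by simp
  moreover have "1 \<le> card (states V) * card (mat_monoid V)"
    using card_states_pos card_monoid_pos by simp
  moreover have "3 * card (mat_monoid V) * card (states V) = 3 * (card (states V) * card (mat_monoid V))"
    by simp
  ultimately show ?thesis by linarith
qed

lemma signed_units_image: "signed_units d = (\<lambda>(\<sigma>, i). \<sigma> \<cdot>\<^sub>v unit_vec d i) ` ({1, -1} \<times> {..<d})"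
  by (auto simp: signed_units_def)

lemma finite_signed_units: "finite (signed_units d)"
  by (simp add: signed_units_image)

lemma card_signed_units: "card (signed_units d) \<le> 2 * d"
  unfolding signed_units_image by (rule order_trans[OF card_image_le]) (auto simp: card_cartesian_product)

text \<open>Enlarging \<open>R\<close> to full products turns the transitions into images of finite
  products, whose cardinalities are immediate.\<close>

lemma sim_transitions_subset: "sim_transitions \<nu> V p q \<subseteq>
   (\<lambda>(M, r, A, b, s). (node \<nu> s M, 1\<^sub>m (2 * d), 0\<^sub>v d @\<^sub>v M *\<^sub>v b, node \<nu> r (M * A)))
     ` (mat_monoid V \<times> transitions V) \<union>
   (\<lambda>M. (node \<nu> p M, 1\<^sub>m (2 * d), 0\<^sub>v d @\<^sub>v 0\<^sub>v d, transfer M)) ` mat_monoid V \<union>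
   (\<lambda>(M, x). (transfer M, 1\<^sub>m (2 * d), - x @\<^sub>v M *\<^sub>v x, transfer M)) ` (mat_monoid V \<times> signed_units d) \<union>
   (\<lambda>M. (transfer M, 1\<^sub>m (2 * d), 0\<^sub>v d @\<^sub>v 0\<^sub>v d, final)) ` mat_monoid V"
  (is "_ \<subseteq> ?W \<union> ?N \<union> ?L \<union> ?X")
proof (rule subrelI)
  fix s' z assume "(s', z) \<in> sim_transitions \<nu> V p q"
  moreover obtain A' b' r' where "z = (A', b', r')" by (cases z)
  ultimately have "(s', A', b', r') \<in> sim_transitions \<nu> V p q" by simp
  then have "(s', A', b', r') \<in> ?W \<union> ?N \<union> ?L \<union> ?X"
  proof (cases rule: sim_transitions_cases)
    case (walk s M r A b)
    then show ?thesis using R_D(2)[of s M]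
      by (intro UnI1 image_eqI[of _ _ "(M, r, A, b, s)"]) auto
  qed (use R_D(2) in auto)
  then show "(s', z) \<in> ?W \<union> ?N \<union> ?L \<union> ?X" using \<open>z = _\<close> by simp
qed

lemma finite_sim_transitions: "finite (sim_transitions \<nu> V p q)"
  by (rule finite_subset[OF sim_transitions_subset])
    (use fin_monoid finite_transitions finite_signed_units in auto)

text \<open>Per matrix there are at most \<open>|T|\<close> walking transitions,
  \<open>2 * d\<close> loops, one entry and one exit. For \<open>d\<close> at least 1 and
  \<open>Q\<close> nonempty, \<open>|T| + 2 + 2 * d\<close> is at most
  \<open>4 * d * (|Q| + |T|)\<close>.\<close>

lemma card_sim_transitions:
  assumes "d \<noteq> 0"
  shows "card (sim_transitions \<nu> V p q)
    \<le> 4 * d * card (mat_monoid V) * (card (states V) + card (transitions V))"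
proof -
  let ?m = "card (mat_monoid V)"
  \<comment> \<open>Only the domains of the four covering maps matter for counting, so the maps
    themselves are made opaque.\<close>
  obtain f g h k where cover: "sim_transitions \<nu> V p q \<subseteq>
      f ` (mat_monoid V \<times> transitions V) \<union> g ` mat_monoid V \<union>
      h ` (mat_monoid V \<times> signed_units d) \<union> k ` mat_monoid V" (is "_ \<subseteq> ?W \<union> ?N \<union> ?L \<union> ?X")
    using sim_transitions_subset by (rule that)
  have finite: "finite (mat_monoid V \<times> transitions V)" "finite (mat_monoid V \<times> signed_units d)"
    using fin_monoid finite_transitions finite_signed_units by simp_all
  have "card (sim_transitions \<nu> V p q) \<le> card (?W \<union> ?N \<union> ?L \<union> ?X)"
    using fin_monoid finite by (intro card_mono[OF _ cover]) simp
  also have "\<dots> \<le> card ?W + card ?N + card ?L + card ?X"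
    by (intro order_trans[OF card_Un_le] add_mono order_refl)
  also have "\<dots> \<le> card (mat_monoid V \<times> transitions V) + ?m + card (mat_monoid V \<times> signed_units d) + ?m"
    by (intro add_mono card_image_le finite fin_monoid)
  also have "\<dots> = ?m * card (transitions V) + ?m + ?m * card (signed_units d) + ?m"
    by (simp only: card_cartesian_product)
  also have "\<dots> \<le> ?m * card (transitions V) + ?m + ?m * (2 * d) + ?m"
    using card_signed_units by simp
  also have "\<dots> = ?m * (card (transitions V) + 2 + 2 * d)" by (simp add: algebra_simps)
  also have "\<dots> \<le> ?m * (4 * d * (card (states V) + card (transitions V)))"
  proof (rule mult_le_mono2)
    have "card (transitions V) \<le> 4 * d * card (transitions V)" "4 * d \<le> 4 * d * card (states V)"
      using assms card_states_pos by auto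
    then show "card (transitions V) + 2 + 2 * d \<le> 4 * d * (card (states V) + card (transitions V))"
      using assms unfolding distrib_left by linarith
  qed
  finally show ?thesis by (simp add: mult.commute mult.left_commute)
qed

section \<open>Well-formedness and norm of the simulation\<close>

lemma zvass_sim: "zvass (sim \<nu> V p q)"
proof -
  have "s' \<in> sim_states \<nu> V p q \<and> A' = 1\<^sub>m (2 * d) \<and> b' \<in> carrier_vec (2 * d) \<and> r' \<in> sim_states \<nu> V p q"
    if "(s', A', b', r') \<in> sim_transitions \<nu> V p q" for s' A' b' r'
    using that
  proof (cases rule: sim_transitions_cases)
    case (walk s M r A b)
    then show ?thesis
      using R_D(3)[of s M] transitionsD[of r A b s] backward_pairs_extend[of s M V q r A b]
      by (auto simp: sim_states_def mult_2)
  next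
    case (move M x)
    then show ?thesis
      using R_D(3)[of p M] signed_units_carrier[of x d] by (auto simp: sim_states_def mult_2)
  qed (auto simp: sim_states_def mult_2)
  moreover have "finite (sim_states \<nu> V p q)"
    unfolding sim_states_image using finite_R finite_start_fibre by simp
  ultimately show ?thesis
    using finite_sim_transitions unfolding zvass_def affine_zvass_def by fastforce
qed

text \<open>The bound \<open>K\<close> is left abstract so that the general and the conditional norm
  estimate are both instances. As \<open>d\<close> is positive and the identity lies in the monoid,
  \<open>K\<close> is at least 1, which takes care of the identity matrices and of the unit vectors
  in the first half.\<close>

lemma norm_sim_transitions_le:
  assumes "d \<noteq> 0" "norm_mats (mat_monoid V) \<le> K"
    and "\<And>B r A b s. B \<in> mat_monoid V \<Longrightarrow> (r, A, b, s) \<in> transitions V \<Longrightarrow> norm_vec (B *\<^sub>v b) \<le> K"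
  shows "norm_trans (sim_transitions \<nu> V p q) \<le> K"
proof (rule norm_trans_leI[OF finite_sim_transitions])
  have "1 \<le> norm_mat (1\<^sub>m d :: int mat)"
    using norm_mat_ge[of 0 "1\<^sub>m d :: int mat" 0] assms(1) by simp
  then have K: "1 \<le> K"
    using norm_mats_ge[OF fin_monoid mat_monoid.one] assms(2) by linarith
  then show "0 \<le> K" by simp
  have MK: "norm_mat M \<le> K" if "M \<in> mat_monoid V" for M
    using norm_mats_ge[OF fin_monoid that] assms(2) by simp
  fix s' A' b' r'
  assume "(s', A', b', r') \<in> sim_transitions \<nu> V p q"
  then have "A' = 1\<^sub>m (2 * d) \<and> norm_vec b' \<le> K"
  proof (cases rule: sim_transitions_cases)
    case (walk s M r A b)
    have "norm_vec (0\<^sub>v d @\<^sub>v M *\<^sub>v b) \<le> K"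
      using K assms(3)[OF R_D(2)[OF walk(5)] walk(6)]
      by (intro norm_vec_append_leI) (auto intro!: norm_vec_leI)
    with walk show ?thesis by simp
  next
    case (move M x)
    have "norm_vec (- x @\<^sub>v M *\<^sub>v x) \<le> K"
    proof (intro norm_vec_append_leI norm_vec_leI)
      fix i assume "i < dim_vec (- x)"
      then show "\<bar>(- x) $ i\<bar> \<le> K"
        using K signed_unit_abs_le[OF move(6), of i] signed_units_carrier[OF move(6)] by auto
    next
      fix i assume "i < dim_vec (M *\<^sub>v x)"
      then show "\<bar>(M *\<^sub>v x) $ i\<bar> \<le> K"
        using mult_signed_unit_abs_le[OF move(6) R_D(3)[OF move(5)], of i]
          MK[OF R_D(2)[OF move(5)]] R_D(3)[OF move(5)] by auto
    qed (use K in auto)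
    with move show ?thesis by simp
  qed (use K in \<open>auto intro!: norm_vec_leI\<close>)
  then show "norm_vec b' \<le> K \<and> norm_mat A' \<le> K"
    using K by (auto intro!: norm_mat_leI)
qed

section \<open>Equivalence of reachability in the machine and in its simulation\<close>

lemma sim_step:
  assumes "(s', 1\<^sub>m (2 * d), b @\<^sub>v b', r') \<in> sim_transitions \<nu> V p q"
    and "x \<in> carrier_vec d" "y \<in> carrier_vec d" "b \<in> carrier_vec d" "b' \<in> carrier_vec d"
  shows "reach (sim \<nu> V p q) (s', x @\<^sub>v y) (r', (x + b) @\<^sub>v (y + b'))"
proof (rule reach_Cons)
  have "s' \<in> sim_states \<nu> V p q" "r' \<in> sim_states \<nu> V p q"
    using zvass_sim assms(1) by (auto simp: zvass_def affine_zvass_def)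
  then show "(s', x @\<^sub>v y) \<in> configs (sim \<nu> V p q)"
    "reach (sim \<nu> V p q) (r', 1\<^sub>m (2 * d) *\<^sub>v (x @\<^sub>v y) + (b @\<^sub>v b')) (r', (x + b) @\<^sub>v (y + b'))"
    using assms by (auto simp: configs_def mult_2 append_vec_add[of _ d _ _ d] intro!: reach_refl)
qed (use assms in simp)

lemma sim_walk:
  assumes "backward V q s M c" "u \<in> carrier_vec d"
  shows "reach (sim \<nu> V p q) (node \<nu> q (1\<^sub>m d), u @\<^sub>v 0\<^sub>v d) (node \<nu> s M, u @\<^sub>v c)"
  using assms(1)
proof induction
  case start
  then show ?case
    using assms(2) backward_pairs_start[of q V]
    by (intro reach_refl) (auto simp: configs_def sim_states_def mult_2)
next
  case (extend s M c r A b)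
  have R: "(s, M) \<in> R" using extend by (auto simp: backward_pairs_def)
  have "(node \<nu> s M, 1\<^sub>m (2 * d), 0\<^sub>v d @\<^sub>v M *\<^sub>v b, node \<nu> r (M * A)) \<in> sim_transitions \<nu> V p q"
    using R extend unfolding sim_transitions_def Let_def by blast
  from sim_step[OF this assms(2) backward_closed(3)[OF affine q extend(1)]]
  have "reach (sim \<nu> V p q) (node \<nu> s M, u @\<^sub>v c) (node \<nu> r (M * A), u @\<^sub>v (c + M *\<^sub>v b))"
    using R_D(3)[OF R] transitionsD[OF extend(2)] assms(2) by simp
  then show ?case by (rule reach_trans[OF extend.IH])
qed

text \<open>Induction on the sum of the absolute values of \<open>y\<close>: the loop for a signed
  unit vector \<open>x\<close> at a nonzero coordinate moves that coordinate one step towards 0,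
  leaves the others alone, and preserves \<open>z + M *\<^sub>v y\<close> by linearity.\<close>

lemma sim_transfer:
  assumes "(p, M) \<in> R" "y \<in> carrier_vec d" "z \<in> carrier_vec d"
  shows "reach (sim \<nu> V p q) (transfer M, y @\<^sub>v z) (transfer M, 0\<^sub>v d @\<^sub>v (z + M *\<^sub>v y))"
  using assms(2,3)
proof (induction "\<Sum>i<d. nat \<bar>y $ i\<bar>" arbitrary: y z rule: less_induct)
  case less
  note M = R_D(3)[OF assms(1)]
  show ?case
  proof (cases "y = 0\<^sub>v d")
    case True
    then show ?thesis
      using less.prems assms(1) mult_mat_zero_vec[OF M] by (auto simp: configs_def sim_states_def mult_2 intro!: reach_refl)
  next
    case False
    then obtain i where i: "i < d" "y $ i \<noteq> 0"
      using less.prems by (auto simp: vec_eq_iff)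
    define x where "x = sgn (y $ i) \<cdot>\<^sub>v (unit_vec d i :: int vec)"
    have x: "x \<in> signed_units d"
      using i unfolding x_def signed_units_def
      by (intro CollectI exI[of _ "sgn (y $ i)"] exI[of _ i]) (auto simp: sgn_if)
    note xc = signed_units_carrier[OF x]
    have "(transfer M, 1\<^sub>m (2 * d), - x @\<^sub>v M *\<^sub>v x, transfer M) \<in> sim_transitions \<nu> V p q"
      using x assms(1) unfolding sim_transitions_def Let_def by blast
    from sim_step[OF this less.prems] xc M
    have 1: "reach (sim \<nu> V p q) (transfer M, y @\<^sub>v z) (transfer M, (y + - x) @\<^sub>v (z + M *\<^sub>v x))"
      by simp
    have "(\<Sum>j<d. nat \<bar>(y + - x) $ j\<bar>) < (\<Sum>j<d. nat \<bar>y $ j\<bar>)"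
    proof (rule sum_strict_mono_ex1)
      have *: "(y + - x) $ j = (if j = i then y $ i - sgn (y $ i) else y $ j)" if "j < d" for j
        using that i less.prems by (auto simp: x_def)
      show "\<forall>j\<in>{..<d}. nat \<bar>(y + - x) $ j\<bar> \<le> nat \<bar>y $ j\<bar>"
        by (auto simp: * sgn_if)
      show "\<exists>j\<in>{..<d}. nat \<bar>(y + - x) $ j\<bar> < nat \<bar>y $ j\<bar>"
        using i by (intro bexI[of _ i]) (auto simp: * sgn_if)
    qed simp
    from less.hyps[OF this, of "z + M *\<^sub>v x"] have "reach (sim \<nu> V p q) (transfer M, (y + - x) @\<^sub>v (z + M *\<^sub>v x))
        (transfer M, 0\<^sub>v d @\<^sub>v (z + M *\<^sub>v x + M *\<^sub>v (y + - x)))"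
      using xc M less.prems by simp
    moreover have "z + M *\<^sub>v x + M *\<^sub>v (y + - x) = z + M *\<^sub>v y"
    proof -
      have "x + (y + - x) = y" using xc less.prems by (auto simp: vec_eq_iff)
      then have "M *\<^sub>v y = M *\<^sub>v x + M *\<^sub>v (y + - x)"
        using mult_add_distrib_mat_vec[OF M xc, of "y + - x"] xc less.prems by simp
      then show ?thesis
        using xc M less.prems by (simp add: assoc_add_vec[of _ d])
    qed
    ultimately show ?thesis using reach_trans[OF 1] by simp
  qed
qed

text \<open>While walking, the first half is still \<open>u\<close>. Afterwards the loops may stop
  too early or overshoot, so only \<open>z + M *\<^sub>v y\<close> is controlled, and it keeps the
  value it has on entry. The matrix is quantified existentially because the final state no longer
  records it.\<close>

lemma sim_invariant:
  assumes "reach (sim \<nu> V p q) (node \<nu> q (1\<^sub>m d), u @\<^sub>v 0\<^sub>v d) e" "u \<in> carrier_vec d"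
  shows "(\<exists>s M c. e = (node \<nu> s M, u @\<^sub>v c) \<and> backward V q s M c) \<or>
     (\<exists>M c y z. (fst e = transfer M \<or> fst e = final) \<and> snd e = y @\<^sub>v z \<and> backward V q p M c \<and>
        y \<in> carrier_vec d \<and> z \<in> carrier_vec d \<and> z + M *\<^sub>v y = c + M *\<^sub>v u)"
    (is "?walk e \<or> ?transfer e")
  using assms(1)
proof (induction rule: reach_induct)
  case base
  have "?walk (node \<nu> q (1\<^sub>m d), u @\<^sub>v 0\<^sub>v d)" using backward.start[of V q] by auto
  then show ?case ..
next
  case (step s' x' A' b' r')
  have I: "1\<^sub>m (2 * d) *\<^sub>v (x @\<^sub>v y) + (b @\<^sub>v c) = (x + b) @\<^sub>v (y + c)"
    if "x \<in> carrier_vec d" "y \<in> carrier_vec d" "b \<in> carrier_vec d" "c \<in> carrier_vec d" for x y b c :: "int vec"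
    using that by (simp add: append_vec_add[of _ d _ _ d] mult_2)
  \<comment> \<open>The invariant provides some pair with the name \<open>s'\<close>; injectivity of
    \<open>node\<close> on \<open>R\<close> identifies it with the source of the present transition,
    while the tags rule out the other disjunct.\<close>
  have at_node: "\<exists>c. x' = u @\<^sub>v c \<and> backward V q s M c" if at: "s' = node \<nu> s M" "(s, M) \<in> R" for s M
  proof -
    obtain t N c where *: "s' = node \<nu> t N" "x' = u @\<^sub>v c" "backward V q t N c"
      using step(1) at(1) by auto
    with at have "t = s" "N = M"
      using node_eq_iff[of t N s M] by (auto simp: backward_pairs_def)
    with * show ?thesis by blast
  qed
  have at_transfer: "\<exists>c y z. x' = y @\<^sub>v z \<and> backward V q p M c \<and> y \<in> carrier_vec d \<and> z \<in> carrier_vec d \<and>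
      z + M *\<^sub>v y = c + M *\<^sub>v u" if at: "s' = transfer M" "(p, M) \<in> R" for M
  proof -
    obtain N c y z where *: "s' = transfer N" "x' = y @\<^sub>v z" "backward V q p N c" "y \<in> carrier_vec d"
      "z \<in> carrier_vec d" "z + N *\<^sub>v y = c + N *\<^sub>v u"
      using step(1) at(1) by auto
    with at have "N = M"
      using transfer_eq_iff[of p N p M] by (auto simp: backward_pairs_def)
    with * show ?thesis by blast
  qed
  from step(3)[simplified] show ?case
  proof (cases rule: sim_transitions_cases)
    case (walk s M r A b)
    then obtain c where c: "x' = u @\<^sub>v c" "backward V q s M c"
      using at_node[OF walk(1,5)] by auto
    have "A' *\<^sub>v x' + b' = u @\<^sub>v (c + M *\<^sub>v b)"
      using walk c I[OF assms(2) backward_closed(3)[OF affine q c(2)], of "0\<^sub>v d" "M *\<^sub>v b"]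
        R_D(3)[OF walk(5)] transitionsD[OF walk(6)] assms(2) by simp
    then have "?walk (r', A' *\<^sub>v x' + b')"
      using walk(4) backward.extend[OF c(2) walk(6)] by auto
    then show ?thesis ..
  next
    case (enter M)
    then obtain c where c: "x' = u @\<^sub>v c" "backward V q p M c"
      using at_node[OF enter(1,5)] by auto
    note cc = backward_closed(3)[OF affine q c(2)]
    have "A' *\<^sub>v x' + b' = u @\<^sub>v c"
      using enter c I[OF assms(2) cc, of "0\<^sub>v d" "0\<^sub>v d"] assms(2) cc by simp
    then show ?thesis using enter c cc assms(2) by auto
  next
    case (move M x)
    then obtain c y z where *: "x' = y @\<^sub>v z" "backward V q p M c" "y \<in> carrier_vec d" "z \<in> carrier_vec d"
      "z + M *\<^sub>v y = c + M *\<^sub>v u" using at_transfer[OF move(1,5)] by auto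
    note M = R_D(3)[OF move(5)] and x = signed_units_carrier[OF move(6)]
    have e: "A' *\<^sub>v x' + b' = (y + - x) @\<^sub>v (z + M *\<^sub>v x)"
      using move * I[OF *(3,4), of "- x" "M *\<^sub>v x"] M x by simp
    have "x + (y + - x) = y" using x * by (auto simp: vec_eq_iff)
    then have "M *\<^sub>v y = M *\<^sub>v x + M *\<^sub>v (y + - x)"
      using mult_add_distrib_mat_vec[OF M x, of "y + - x"] x * by simp
    then have "z + M *\<^sub>v x + M *\<^sub>v (y + - x) = z + M *\<^sub>v y"
      using x M * by (simp add: assoc_add_vec[of _ d])
    then have "?transfer (r', A' *\<^sub>v x' + b')"
      using * e move x M
      by (intro exI[of _ M] exI[of _ c] exI[of _ "y + - x"] exI[of _ "z + M *\<^sub>v x"]) auto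
    then show ?thesis ..
  next
    case (exit M)
    then obtain c y z where *: "x' = y @\<^sub>v z" "backward V q p M c" "y \<in> carrier_vec d" "z \<in> carrier_vec d"
      "z + M *\<^sub>v y = c + M *\<^sub>v u" using at_transfer[OF exit(1,5)] by auto
    have "A' *\<^sub>v x' + b' = y @\<^sub>v z"
      using exit * I[OF *(3,4), of "0\<^sub>v d" "0\<^sub>v d"] by simp
    then have "?transfer (r', A' *\<^sub>v x' + b')" using * exit by auto
    then show ?thesis ..
  qed
qed

text \<open>The simulating run begins at a copy of the target \<open>q\<close>, with nothing read
  yet; the source \<open>p\<close> shows only in where it may leave the nodes.\<close>

lemma reach_sim_iff:
  assumes u: "u \<in> carrier_vec d" and v: "v \<in> carrier_vec d"
  shows "reach V (p, u) (q, v) \<longleftrightarrow>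
    reach (sim \<nu> V p q) (node \<nu> q (1\<^sub>m d), u @\<^sub>v 0\<^sub>v d) (final, 0\<^sub>v d @\<^sub>v v)"
proof
  assume "reach V (p, u) (q, v)"
  then obtain M c where M: "backward V q p M c" "v = M *\<^sub>v u + c"
    using reach_iff_backward[OF affine q p u] by blast
  then have R: "(p, M) \<in> R" by (auto simp: backward_pairs_def)
  note c = backward_closed(3)[OF affine q M(1)]
  have cv: "c + M *\<^sub>v u = v"
    using M(2) c R_D(3)[OF R] u by (simp add: comm_add_vec[of _ d])
  have "(node \<nu> p M, 1\<^sub>m (2 * d), 0\<^sub>v d @\<^sub>v 0\<^sub>v d, transfer M) \<in> sim_transitions \<nu> V p q"
    "(transfer M, 1\<^sub>m (2 * d), 0\<^sub>v d @\<^sub>v 0\<^sub>v d, final) \<in> sim_transitions \<nu> V p q"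
    using R unfolding sim_transitions_def Let_def by blast+
  from sim_step[OF this(1) u c] sim_step[OF this(2) zero_carrier_vec v] u c v
  have "reach (sim \<nu> V p q) (node \<nu> p M, u @\<^sub>v c) (transfer M, u @\<^sub>v c)"
    "reach (sim \<nu> V p q) (transfer M, 0\<^sub>v d @\<^sub>v v) (final, 0\<^sub>v d @\<^sub>v v)" by simp_all
  moreover have "reach (sim \<nu> V p q) (transfer M, u @\<^sub>v c) (transfer M, 0\<^sub>v d @\<^sub>v v)"
    using sim_transfer[OF R u c] cv by simp
  ultimately show "reach (sim \<nu> V p q) (node \<nu> q (1\<^sub>m d), u @\<^sub>v 0\<^sub>v d) (final, 0\<^sub>v d @\<^sub>v v)"
    using reach_trans[OF sim_walk[OF M(1) u]] reach_trans by blast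
next
  assume "reach (sim \<nu> V p q) (node \<nu> q (1\<^sub>m d), u @\<^sub>v 0\<^sub>v d) (final, 0\<^sub>v d @\<^sub>v v)"
  from sim_invariant[OF this u] obtain M c y z where *: "0\<^sub>v d @\<^sub>v v = y @\<^sub>v z" "backward V q p M c"
    "y \<in> carrier_vec d" "z \<in> carrier_vec d" "z + M *\<^sub>v y = c + M *\<^sub>v u" by auto
  then have R: "(p, M) \<in> R" by (auto simp: backward_pairs_def)
  note M = R_D(3)[OF R] and c = backward_closed(3)[OF affine q *(2)]
  \<comment> \<open>The target configuration demands a zero first half: this is what certifies that
    all of \<open>u\<close> has been transferred.\<close>
  have "y = 0\<^sub>v d" "z = v" using *(1) append_vec_eq[OF zero_carrier_vec *(3)] by auto
  with * M c u mult_mat_zero_vec[OF M] have "v = M *\<^sub>v u + c" by (simp add: comm_add_vec[of c d])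
  then show "reach V (p, u) (q, v)"
    using reach_iff_backward[OF affine q p u] *(2) by blast
qed

end

section \<open>Computing the simulation\<close>

text \<open>Indexing is composed from \<open>drop\<close> and \<open>hd\<close>, whose computability
  is established. Out of range its value is unspecified, but on lists that represent vectors and
  matrices of dimension \<open>d\<close> no such access occurs.\<close>

definition entry :: "'a list \<Rightarrow> nat \<Rightarrow> 'a" where
  "entry xs i = hd (drop i xs)"

definition mat_vec_list :: "nat \<Rightarrow> int list list \<Rightarrow> int list \<Rightarrow> int list" where
  "mat_vec_list d A v =
     map (\<lambda>i. sum_list (map (\<lambda>j. entry (entry A i) j * entry v j) [0..<d])) [0..<d]"

definition mat_mult_list :: "nat \<Rightarrow> int list list \<Rightarrow> int list list \<Rightarrow> int list list" where
  "mat_mult_list d A B =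
     map (\<lambda>i. map (\<lambda>k. sum_list (map (\<lambda>j. entry (entry A i) j * entry (entry B j) k) [0..<d])) [0..<d]) [0..<d]"

definition zero_list :: "nat \<Rightarrow> int list" where
  "zero_list d = map (\<lambda>_. 0) [0..<d]"

definition scaled_unit_list :: "nat \<Rightarrow> int \<Rightarrow> nat \<Rightarrow> int list" where
  "scaled_unit_list d \<sigma> i = map (\<lambda>j. if j = i then \<sigma> else 0) [0..<d]"

definition one_list :: "nat \<Rightarrow> int list list" where
  "one_list d = map (scaled_unit_list d 1) [0..<d]"

definition signed_units_list :: "nat \<Rightarrow> int list list" where
  "signed_units_list d = concat (map (\<lambda>i. map (\<lambda>\<sigma>. scaled_unit_list d \<sigma> i) [1, -1]) [0..<d])"

type_synonym list_transition = "nat \<times> int list list \<times> int list \<times> nat"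

abbreviation src :: "list_transition \<Rightarrow> nat" where "src t \<equiv> fst t"
abbreviation mat_of :: "list_transition \<Rightarrow> int list list" where "mat_of t \<equiv> fst (snd t)"
abbreviation shift_of :: "list_transition \<Rightarrow> int list" where "shift_of t \<equiv> fst (snd (snd t))"
abbreviation tgt :: "list_transition \<Rightarrow> nat" where "tgt t \<equiv> snd (snd (snd t))"

definition predecessors ::
    "nat \<Rightarrow> list_transition list \<Rightarrow> nat \<times> int list list \<Rightarrow> (nat \<times> int list list) list" where
  "predecessors d ts z =
     map (\<lambda>t. (src t, mat_mult_list d (snd z) (mat_of t))) (filter (\<lambda>t. tgt t = fst z) ts)"

text \<open>Saturation by rounds. Each round keeps the old list and may repeat entries; only the
  underlying set is of interest.\<close>

definition pairs_upto ::
    "nat \<Rightarrow> list_transition list \<Rightarrow> nat \<Rightarrow> nat \<Rightarrow> (nat \<times> int list list) list" where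
  "pairs_upto d ts q n =
     ((\<lambda>xs. xs @ concat (map (predecessors d ts) xs)) ^^ n) [(q, one_list d)]"

definition closed_pairs :: "nat \<Rightarrow> list_transition list \<Rightarrow> (nat \<times> int list list) list \<Rightarrow> bool" where
  "closed_pairs d ts xs \<longleftrightarrow> (\<forall>z \<in> set (concat (map (predecessors d ts) xs)). z \<in> set xs)"

definition fibre :: "nat \<Rightarrow> (nat \<times> int list list) list \<Rightarrow> int list list list" where
  "fibre p xs = map snd (filter (\<lambda>z. fst z = p) xs)"

definition node_list :: "nat \<Rightarrow> int list list \<Rightarrow> nat" where
  "node_list s M = enc (0::nat, s, M)"

definition transfer_list :: "int list list \<Rightarrow> nat" where
  "transfer_list M = enc (1::nat, 0::nat, M)"

definition states_list :: "nat \<Rightarrow> (nat \<times> int list list) list \<Rightarrow> nat list" where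
  "states_list p xs =
     map (\<lambda>z. node_list (fst z) (snd z)) xs @ map transfer_list (fibre p xs) @ [final]"

definition transitions_list ::
    "nat \<Rightarrow> list_transition list \<Rightarrow> nat \<Rightarrow> (nat \<times> int list list) list \<Rightarrow> list_transition list" where
  "transitions_list d ts p xs =
     concat (map (\<lambda>z. map (\<lambda>t. (node_list (fst z) (snd z), one_list (2 * d),
         zero_list d @ mat_vec_list d (snd z) (shift_of t),
         node_list (src t) (mat_mult_list d (snd z) (mat_of t)))) (filter (\<lambda>t. tgt t = fst z) ts)) xs) @
     map (\<lambda>M. (node_list p M, one_list (2 * d), zero_list d @ zero_list d, transfer_list M)) (fibre p xs) @
     concat (map (\<lambda>M. map (\<lambda>x. (transfer_list M, one_list (2 * d), map uminus x @ mat_vec_list d M x,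
         transfer_list M)) (signed_units_list d)) (fibre p xs)) @
     map (\<lambda>M. (transfer_list M, one_list (2 * d), zero_list d @ zero_list d, final)) (fibre p xs)"

text \<open>In dimension 0 the transition bound is 0, so reachability must be decided here and stored in
  the choice of the target state.\<close>

definition sim_output ::
    "nat \<Rightarrow> list_transition list \<Rightarrow> nat \<Rightarrow> nat \<Rightarrow> (nat \<times> int list list) list
      \<Rightarrow> (nat \<times> nat \<times> nat) \<times> nat \<times> nat" where
  "sim_output d ts p q xs =
     (if d = 0 then ((0, set_encode (set [0, 1]), 0), 0, if (p, []) \<in> set xs then 0 else 1)
      else ((2 * d, set_encode (set (states_list p xs)), set_encode (set (map enc (transitions_list d ts p xs)))),
        node_list q (one_list d), final))"

section \<open>Computability of the list operations\<close>

lemma computable_entry [computable_intros]: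
  assumes "computable l" "computable k" shows "computable (\<lambda>x. entry (l x) (k x))"
  unfolding entry_def by (intro computable_intros assms)

lemma computable_mat_vec_list [computable_intros]:
  assumes "computable d" "computable A" "computable v"
  shows "computable (\<lambda>x. mat_vec_list (d x) (A x) (v x))"
  unfolding mat_vec_list_def by (intro computable_intros assms assms[THEN computable_comp])

lemma computable_mat_mult_list [computable_intros]:
  assumes "computable d" "computable A" "computable B"
  shows "computable (\<lambda>x. mat_mult_list (d x) (A x) (B x))"
  unfolding mat_mult_list_def by (intro computable_intros assms assms[THEN computable_comp])

lemma computable_zero_list [computable_intros]:
  assumes "computable d" shows "computable (\<lambda>x. zero_list (d x))"
  unfolding zero_list_def by (intro computable_intros assms)

lemma computable_scaled_unit_list [computable_intros]:
  assumes "computable d" "computable \<sigma>" "computable i"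
  shows "computable (\<lambda>x. scaled_unit_list (d x) (\<sigma> x) (i x))"
  unfolding scaled_unit_list_def by (intro computable_intros assms assms[THEN computable_comp])

lemma computable_one_list [computable_intros]:
  assumes "computable d" shows "computable (\<lambda>x. one_list (d x))"
  unfolding one_list_def by (intro computable_intros assms assms[THEN computable_comp])

lemma computable_signed_units_list [computable_intros]:
  assumes "computable d" shows "computable (\<lambda>x. signed_units_list (d x))"
  unfolding signed_units_list_def by (intro computable_intros assms assms[THEN computable_comp])

lemma computable_predecessors [computable_intros]:
  assumes "computable d" "computable ts" "computable z"
  shows "computable (\<lambda>x. predecessors (d x) (ts x) (z x))"
  unfolding predecessors_def by (intro computable_intros assms assms[THEN computable_comp])

lemma computable_pairs_upto [computable_intros]:
  assumes "computable d" "computable ts" "computable q" "computable n"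
  shows "computable (\<lambda>x. pairs_upto (d x) (ts x) (q x) (n x))"
  unfolding pairs_upto_def by (intro computable_intros assms assms[THEN computable_comp])

lemma decidable_closed_pairs [computable_intros]:
  assumes "computable d" "computable ts" "computable xs"
  shows "decidable (\<lambda>x. closed_pairs (d x) (ts x) (xs x))"
  unfolding closed_pairs_def by (intro computable_intros assms assms[THEN computable_comp])

lemma computable_fibre [computable_intros]:
  assumes "computable p" "computable xs" shows "computable (\<lambda>x. fibre (p x) (xs x))"
  unfolding fibre_def by (intro computable_intros assms assms[THEN computable_comp])

lemma computable_node_list [computable_intros]:
  assumes "computable s" "computable M" shows "computable (\<lambda>x. node_list (s x) (M x))"
  unfolding node_list_def by (intro computable_intros assms)

lemma computable_transfer_list [computable_intros]:
  assumes "computable M" shows "computable (\<lambda>x. transfer_list (M x))"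
  unfolding transfer_list_def by (intro computable_intros assms)

lemma computable_states_list [computable_intros]:
  assumes "computable p" "computable xs" shows "computable (\<lambda>x. states_list (p x) (xs x))"
  unfolding states_list_def by (intro computable_intros assms assms[THEN computable_comp])

lemma computable_transitions_list [computable_intros]:
  assumes "computable d" "computable ts" "computable p" "computable xs"
  shows "computable (\<lambda>x. transitions_list (d x) (ts x) (p x) (xs x))"
  unfolding transitions_list_def by (intro computable_intros assms assms[THEN computable_comp])

lemma computable_sim_output [computable_intros]:
  assumes "computable d" "computable ts" "computable p" "computable q" "computable xs"
  shows "computable (\<lambda>x. sim_output (d x) (ts x) (p x) (q x) (xs x))"
  unfolding sim_output_def by (intro computable_intros assms assms[THEN computable_comp])


section \<open>Agreement of the list operations with those on vectors and matrices\<close>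

lemma entry_mat_list:
  assumes "M \<in> carrier_mat d d" "i < d" "j < d"
  shows "entry (entry (mat_list M) i) j = M $$ (i, j)"
  using assms by (simp add: entry_def mat_list_def hd_drop_conv_nth)

lemma entry_list_of_vec: "i < dim_vec v \<Longrightarrow> entry (list_of_vec v) i = v $ i"
  by (simp add: entry_def hd_drop_conv_nth)

lemma list_of_vec_eqI: "length xs = dim_vec v \<Longrightarrow> (\<And>i. i < dim_vec v \<Longrightarrow> xs ! i = v $ i) \<Longrightarrow> list_of_vec v = xs"
  by (rule nth_equalityI) auto

lemma mat_vec_list:
  assumes "M \<in> carrier_mat d d" "v \<in> carrier_vec d"
  shows "mat_vec_list d (mat_list M) (list_of_vec v) = list_of_vec (M *\<^sub>v v)"
proof (rule list_of_vec_eqI[symmetric])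
  fix i assume "i < dim_vec (M *\<^sub>v v)"
  then have i: "i < d" using assms by simp
  then show "mat_vec_list d (mat_list M) (list_of_vec v) ! i = (M *\<^sub>v v) $ i"
    using assms by (simp add: mat_vec_list_def scalar_prod_def interv_sum_list_conv_sum_set_nat
        entry_mat_list[OF assms(1)] entry_list_of_vec)
qed (use assms in \<open>simp add: mat_vec_list_def\<close>)

lemma mat_mult_list:
  assumes "A \<in> carrier_mat d d" "B \<in> carrier_mat d d"
  shows "mat_mult_list d (mat_list A) (mat_list B) = mat_list (A * B)"
proof (rule nth_equalityI)
  fix i assume "i < length (mat_mult_list d (mat_list A) (mat_list B))"
  then have i: "i < d" by (simp add: mat_mult_list_def)
  have "list_of_vec (row (A * B) i) = mat_mult_list d (mat_list A) (mat_list B) ! i"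
    using assms i by (intro list_of_vec_eqI) (simp_all add: mat_mult_list_def scalar_prod_def
        interv_sum_list_conv_sum_set_nat entry_mat_list[OF assms(1)] entry_mat_list[OF assms(2)])
  then show "mat_mult_list d (mat_list A) (mat_list B) ! i = mat_list (A * B) ! i"
    using assms i by (simp add: mat_list_def)
qed (use assms in \<open>simp add: mat_mult_list_def mat_list_def\<close>)

lemma zero_list: "zero_list d = list_of_vec (0\<^sub>v d)"
  by (simp add: zero_list_def map_replicate_trivial)

lemma scaled_unit_list: "scaled_unit_list d \<sigma> i = list_of_vec (\<sigma> \<cdot>\<^sub>v unit_vec d i)"
  by (rule list_of_vec_eqI[symmetric]) (auto simp: scaled_unit_list_def unit_vec_def)

lemma one_list: "one_list d = mat_list (1\<^sub>m d)"
  by (rule nth_equalityI) (auto simp: one_list_def mat_list_def scaled_unit_list)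

lemma set_signed_units_list: "set (signed_units_list d) = list_of_vec ` signed_units d"
proof -
  have "signed_units d = (\<Union>i<d. {1 \<cdot>\<^sub>v unit_vec d i, - 1 \<cdot>\<^sub>v unit_vec d i})"
    unfolding signed_units_def by blast
  then show ?thesis
    by (auto simp: signed_units_list_def scaled_unit_list image_UN simp del: one_smult_vec)
qed

lemma list_of_vec_uminus: "list_of_vec (- x) = map uminus (list_of_vec (x :: int vec))"
  by (rule list_of_vec_eqI) auto

lemma in_set_concat_map_map:
  "y \<in> set (concat (map (\<lambda>a. map (f a) ys) xs)) \<longleftrightarrow> (\<exists>a \<in> set xs. \<exists>b \<in> set ys. y = f a b)"
  by (simp add: image_iff)

definition transition_list :: "('q \<Rightarrow> nat) \<Rightarrow> 'q transition \<Rightarrow> list_transition" where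
  "transition_list \<nu> t = (case t of (r, A, b, s) \<Rightarrow> (\<nu> r, mat_list A, list_of_vec b, \<nu> s))"

text \<open>The prescribed codes coincide with those of the class \<open>coded\<close>, so
  \<open>dec\<close> turns the numbers in the input into structured transitions and
  \<open>enc\<close> yields output of the prescribed form.\<close>

lemma enc_transition_list: "enc (transition_list \<nu> t) = code_transition \<nu> t"
proof -
  have [simp]: "(enc :: int \<Rightarrow> nat) = int_encode" "(enc :: nat \<Rightarrow> nat) = (\<lambda>n. n)"
    by (auto simp: enc_int_def enc_nat_def)
  have vec: "enc (list_of_vec b) = code_vec b" for b
    by (simp add: enc_list_def code_vec_def)
  then have "enc (mat_list A) = code_mat A" for A
    by (simp add: enc_list_def[where 'a = "int list"] code_mat_def mat_list_def o_def)
  with vec show ?thesis by (cases t) (simp add: transition_list_def code_transition_def enc_Pair)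
qed

section \<open>Correctness and termination of the saturation, and the code it outputs\<close>

context simulation
begin

definition pair :: "'q \<times> int mat \<Rightarrow> nat \<times> int list list" where
  "pair z = (\<nu> (fst z), mat_list (snd z))"

context
  fixes ts :: "list_transition list"
  assumes ts: "set ts = transition_list \<nu> ` transitions V"
begin

text \<open>The algorithm compares names of states, so injectivity of the naming is needed to
  conclude that a transition selected by name really enters \<open>s\<close>.\<close>

lemma predecessors_pair:
  assumes "(s, M) \<in> R"
  shows "set (predecessors d ts (pair (s, M))) = pair ` {(r, M * A) | r A b. (r, A, b, s) \<in> transitions V}"
    (is "?L = ?R")
proof
  have mult: "mat_mult_list d (mat_list M) (mat_list A) = mat_list (M * A)"
    if "(r, A, b, s') \<in> transitions V" for r A b s'
    using mat_mult_list R_D(3)[OF assms] transitionsD(2)[OF that] by blast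
  show "?L \<subseteq> ?R"
  proof
    fix y assume "y \<in> ?L"
    then obtain r A b s' where t: "(r, A, b, s') \<in> transitions V" "\<nu> s' = \<nu> s"
      "y = (\<nu> r, mat_mult_list d (mat_list M) (mat_list A))"
      by (auto simp: predecessors_def ts transition_list_def pair_def)
    then have "s' = s"
      using inj_onD[OF inj] transitionsD(4) R_D(1)[OF assms] by blast
    with t mult[OF t(1)] have "y = pair (r, M * A)" "(r, A, b, s) \<in> transitions V"
      by (simp_all add: pair_def)
    then show "y \<in> ?R" by blast
  qed
  show "?R \<subseteq> ?L"
  proof
    fix y assume "y \<in> ?R"
    then obtain r A b where t: "(r, A, b, s) \<in> transitions V" "y = (\<nu> r, mat_list (M * A))"
      by (auto simp: pair_def)
    then show "y \<in> ?L"
      using mult[OF t(1)] by (force simp: predecessors_def ts transition_list_def pair_def)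
  qed
qed

lemma pairs_upto_Suc:
  "pairs_upto d ts k (Suc n) =
     pairs_upto d ts k n @ concat (map (predecessors d ts) (pairs_upto d ts k n))"
  by (simp add: pairs_upto_def)

lemma pairs_upto_subset: "set (pairs_upto d ts (\<nu> q) n) \<subseteq> pair ` R"
proof (induction n)
  case 0
  have "(\<nu> q, one_list d) = pair (q, 1\<^sub>m d)" by (simp add: pair_def one_list)
  then show ?case using backward_pairs_start[of q V] by (auto simp: pairs_upto_def)
next
  case (Suc n)
  have "set (predecessors d ts z) \<subseteq> pair ` R" if "z \<in> pair ` R" for z
    using that predecessors_pair backward_pairs_extend[of _ _ V q] by force
  with Suc show ?case unfolding pairs_upto_Suc set_append set_concat set_map by blast
qed

text \<open>\<open>R\<close> is the least set that contains the start pair and is closed under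
  predecessors. A round never leaves \<open>R\<close>, so a closed round equals it.\<close>

lemma closed_pairs_eq:
  assumes "closed_pairs d ts (pairs_upto d ts (\<nu> q) n)"
  shows "set (pairs_upto d ts (\<nu> q) n) = pair ` R"
proof (rule antisym[OF pairs_upto_subset])
  have start: "pair (q, 1\<^sub>m d) \<in> set (pairs_upto d ts (\<nu> q) n)"
  proof (induction n)
    case 0
    show ?case by (simp add: pairs_upto_def pair_def one_list)
  qed (simp add: pairs_upto_Suc)
  have "pair (s, M) \<in> set (pairs_upto d ts (\<nu> q) n)" if "(s, M) \<in> R" for s M
    using that
  proof (induction rule: backward_pairs_induct)
    case (extend s M r A b)
    then have "pair (r, M * A) \<in> set (predecessors d ts (pair (s, M)))"
      using predecessors_pair[OF extend(1)] by auto
    with extend.IH assms show ?case by (auto simp: closed_pairs_def)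
  qed (rule start)
  then show "pair ` R \<subseteq> set (pairs_upto d ts (\<nu> q) n)" by auto
qed

text \<open>A round that is not closed is followed by a strictly larger one. If none were closed,
  round \<open>n\<close> would have at least \<open>n\<close> members, contradicting the finiteness
  of \<open>R\<close>; this is where the finite-monoid property makes the search terminate.\<close>

lemma ex_closed_pairs: "\<exists>n. closed_pairs d ts (pairs_upto d ts (\<nu> q) n)"
proof (rule ccontr)
  assume *: "\<nexists>n. closed_pairs d ts (pairs_upto d ts (\<nu> q) n)"
  have "n \<le> card (set (pairs_upto d ts (\<nu> q) n))" for n
  proof (induction n)
    case (Suc n)
    have "\<not> closed_pairs d ts (pairs_upto d ts (\<nu> q) n)" using * by blast
    then have "set (pairs_upto d ts (\<nu> q) n) \<subset> set (pairs_upto d ts (\<nu> q) (Suc n))"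
      by (auto simp: pairs_upto_Suc closed_pairs_def)
    then have "card (set (pairs_upto d ts (\<nu> q) n)) < card (set (pairs_upto d ts (\<nu> q) (Suc n)))"
      by (intro psubset_card_mono) simp
    with Suc show ?case by simp
  qed simp
  moreover have "card (set (pairs_upto d ts (\<nu> q) n)) \<le> card (pair ` R)" for n
    using finite_R by (intro card_mono pairs_upto_subset) simp
  ultimately have "Suc (card (pair ` R)) \<le> card (pair ` R)" by (meson order_trans)
  then show False by simp
qed

context
  fixes xs :: "(nat \<times> int list list) list"
  assumes xs: "set xs = pair ` R"
begin

lemma set_fibre: "set (fibre (\<nu> p) xs) = mat_list ` {M. (p, M) \<in> R}"
proof -
  have "s = p" if "(s, M) \<in> R" "\<nu> s = \<nu> p" for s M
    using that inj_onD[OF inj] p R_D(1) by blast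
  then show ?thesis by (force simp: fibre_def xs pair_def)
qed

lemma set_states_list: "set (states_list (\<nu> p) xs) = sim_states \<nu> V p q"
  unfolding states_list_def sim_states_image
  by (simp add: set_fibre xs image_image pair_def node_list_def transfer_list_def node_def
      transfer_def[abs_def] case_prod_unfold)

lemma set_transitions_list:
  "set (transitions_list d ts (\<nu> p) xs) = transition_list id ` sim_transitions \<nu> V p q"
proof -
  let ?t = "transition_list (id :: nat \<Rightarrow> nat)"
  let ?I = "1\<^sub>m (2 * d) :: int mat"
  have mult: "mat_mult_list d (mat_list M) (mat_list A) = mat_list (M * A)"
    "mat_vec_list d (mat_list M) (list_of_vec b) = list_of_vec (M *\<^sub>v b)"
    if "(s, M) \<in> R" "(r, A, b, s') \<in> transitions V" for s M r A b s'
    using mat_mult_list mat_vec_list R_D(3)[OF that(1)] transitionsD(2,3)[OF that(2)] by blast+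
  have unit: "mat_vec_list d (mat_list M) (list_of_vec x) = list_of_vec (M *\<^sub>v x)"
    if "(s, M) \<in> R" "x \<in> signed_units d" for s M x
    using mat_vec_list R_D(3)[OF that(1)] signed_units_carrier[OF that(2)] by blast
  have names [simp]: "node_list (\<nu> s) (mat_list M) = node \<nu> s M" "transfer_list (mat_list M) = transfer M"
    for s M by (simp_all add: node_list_def node_def transfer_list_def transfer_def)
  have walk: "set (concat (map (\<lambda>z. map (\<lambda>t. (node_list (fst z) (snd z), one_list (2 * d),
         zero_list d @ mat_vec_list d (snd z) (shift_of t),
         node_list (src t) (mat_mult_list d (snd z) (mat_of t)))) (filter (\<lambda>t. tgt t = fst z) ts)) xs)) =
    ?t ` {(node \<nu> s M, ?I, 0\<^sub>v d @\<^sub>v M *\<^sub>v b, node \<nu> r (M * A)) | s M r A b.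
        (s, M) \<in> R \<and> (r, A, b, s) \<in> transitions V}" (is "?L = ?t ` ?R")
  proof
    show "?L \<subseteq> ?t ` ?R"
    proof
      fix y assume "y \<in> ?L"
      then obtain s M r A b s' where *: "(s, M) \<in> R" "(r, A, b, s') \<in> transitions V" "\<nu> s' = \<nu> s"
        and y: "y = (node_list (\<nu> s) (mat_list M), one_list (2 * d),
          zero_list d @ mat_vec_list d (mat_list M) (list_of_vec b),
          node_list (\<nu> r) (mat_mult_list d (mat_list M) (mat_list A)))"
        by (auto simp: xs ts pair_def transition_list_def)
      then have "s' = s"
        using inj_onD[OF inj] transitionsD(4) R_D(1) by blast
      moreover have "y = ?t (node \<nu> s M, ?I, 0\<^sub>v d @\<^sub>v M *\<^sub>v b, node \<nu> r (M * A))"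
        using y mult[OF *(1,2)] by (simp add: transition_list_def one_list zero_list del: list_of_vec_0)
      ultimately show "y \<in> ?t ` ?R" using * by blast
    qed
    show "?t ` ?R \<subseteq> ?L"
    proof
      fix y assume "y \<in> ?t ` ?R"
      then obtain s M r A b where *: "(s, M) \<in> R" "(r, A, b, s) \<in> transitions V"
        and y: "y = ?t (node \<nu> s M, ?I, 0\<^sub>v d @\<^sub>v M *\<^sub>v b, node \<nu> r (M * A))" by blast
      have "pair (s, M) \<in> set xs" "transition_list \<nu> (r, A, b, s) \<in> set ts"
        using * xs ts by blast+
      moreover have "y = (node_list (\<nu> s) (mat_list M), one_list (2 * d),
          zero_list d @ mat_vec_list d (mat_list M) (list_of_vec b),
          node_list (\<nu> r) (mat_mult_list d (mat_list M) (mat_list A)))"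
        using y mult[OF *] by (simp add: transition_list_def one_list zero_list del: list_of_vec_0)
      ultimately show "y \<in> ?L"
        by (force simp: pair_def transition_list_def)
    qed
  qed
  have loops: "set (concat (map (\<lambda>M. map (\<lambda>x. (transfer_list M, one_list (2 * d),
         map uminus x @ mat_vec_list d M x, transfer_list M)) (signed_units_list d)) (fibre (\<nu> p) xs))) =
    ?t ` {(transfer M, ?I, - x @\<^sub>v M *\<^sub>v x, transfer M) | M x. (p, M) \<in> R \<and> x \<in> signed_units d}"
    (is "?L = ?t ` ?R")
  proof
    have loop: "?t (transfer M, ?I, - x @\<^sub>v M *\<^sub>v x, transfer M) = (transfer_list (mat_list M), one_list (2 * d),
        map uminus (list_of_vec x) @ mat_vec_list d (mat_list M) (list_of_vec x), transfer_list (mat_list M))"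
      if "(p, M) \<in> R" "x \<in> signed_units d" for M x
      by (simp add: transition_list_def one_list list_of_vec_uminus unit[OF that])
    show "?L \<subseteq> ?t ` ?R"
    proof
      fix y assume "y \<in> ?L"
      then obtain M' x' where "M' \<in> set (fibre (\<nu> p) xs)" "x' \<in> set (signed_units_list d)"
        and y: "y = (transfer_list M', one_list (2 * d), map uminus x' @ mat_vec_list d M' x', transfer_list M')"
        unfolding in_set_concat_map_map by blast
      then obtain M x where *: "(p, M) \<in> R" "x \<in> signed_units d"
        and eqs: "M' = mat_list M" "x' = list_of_vec x"
        unfolding set_fibre set_signed_units_list by blast
      have "y = ?t (transfer M, ?I, - x @\<^sub>v M *\<^sub>v x, transfer M)"
        unfolding y eqs loop[OF *] ..
      with * show "y \<in> ?t ` ?R" by blast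
    qed
    show "?t ` ?R \<subseteq> ?L"
    proof
      fix y assume "y \<in> ?t ` ?R"
      then obtain M x where *: "(p, M) \<in> R" "x \<in> signed_units d"
        and y: "y = ?t (transfer M, ?I, - x @\<^sub>v M *\<^sub>v x, transfer M)" by blast
      have "mat_list M \<in> set (fibre (\<nu> p) xs)" "list_of_vec x \<in> set (signed_units_list d)"
        using * unfolding set_fibre set_signed_units_list by blast+
      then show "y \<in> ?L" unfolding in_set_concat_map_map y loop[OF *] by blast
    qed
  qed
  have enter: "set (map (\<lambda>M. (node_list (\<nu> p) M, one_list (2 * d), zero_list d @ zero_list d,
      transfer_list M)) (fibre (\<nu> p) xs)) =
    ?t ` {(node \<nu> p M, ?I, 0\<^sub>v d @\<^sub>v 0\<^sub>v d, transfer M) | M. (p, M) \<in> R}"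
    by (simp add: setcompr_eq_image set_fibre image_image transition_list_def one_list zero_list)
  have exit: "set (map (\<lambda>M. (transfer_list M, one_list (2 * d), zero_list d @ zero_list d,
      final)) (fibre (\<nu> p) xs)) =
    ?t ` {(transfer M, ?I, 0\<^sub>v d @\<^sub>v 0\<^sub>v d, final) | M. (p, M) \<in> R}"
    by (simp add: setcompr_eq_image set_fibre image_image transition_list_def one_list zero_list)
  show ?thesis
    unfolding transitions_list_def sim_transitions_def Let_def set_append walk loops enter exit
    by (simp only: image_Un Un_assoc)
qed

text \<open>The output uses \<open>xs\<close> only through \<open>set_encode\<close>, so any
  enumeration of \<open>R\<close> gives the same code. The naming is \<open>id\<close> because the
  simulating states are numbers already.\<close>

lemma sim_output_eq_code_instance:
  assumes "d \<noteq> 0"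
  shows "enc (sim_output d ts (\<nu> p) (\<nu> q) xs) =
    code_instance id (sim \<nu> V p q) (node \<nu> q (1\<^sub>m d)) final"
proof -
  have "set (map enc (transitions_list d ts (\<nu> p) xs)) = code_transition id ` sim_transitions \<nu> V p q"
    by (simp add: set_transitions_list image_image enc_transition_list)
  then show ?thesis
    using assms by (simp add: sim_output_def set_states_list code_instance_def code_vass_def enc_Pair
        enc_nat_def one_list node_list_def node_def del: set_map)
qed

text \<open>Every matrix of dimension 0 has the empty list of rows, so the membership test in
  \<open>sim_output\<close> asks whether \<open>p\<close> occurs in \<open>R\<close> at all. The
  source is state 0, and the target coincides with it exactly in that case.\<close>

lemma sim_output_dimension_0:
  assumes "d = 0"
  shows "enc (sim_output d ts (\<nu> p) (\<nu> q) xs) =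
    code_instance id \<lparr>dimension = 0, states = {0, 1}, transitions = {}\<rparr> 0
      (if \<exists>M. (p, M) \<in> R then 0 else 1)"
proof -
  have "mat_list M = []" if "(s, M) \<in> R" for s M
    using R_D(3)[OF that] assms by (simp add: mat_list_def rows_def)
  then have nil: "pair (s, M) = (\<nu> s, [])" if "(s, M) \<in> R" for s M
    using that by (simp add: pair_def)
  have "(\<nu> p, []) \<in> pair ` R \<longleftrightarrow> (\<exists>M. (p, M) \<in> R)"
  proof
    assume "(\<nu> p, []) \<in> pair ` R"
    then obtain s M where sM: "(s, M) \<in> R" "(\<nu> p, []) = pair (s, M)" by (metis imageE surj_pair)
    then have "s = p" using nil[OF sM(1)] inj_onD[OF inj] p R_D(1)[OF sM(1)] by simp
    with sM show "\<exists>M. (p, M) \<in> R" by blast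
  next
    assume "\<exists>M. (p, M) \<in> R"
    then obtain M where M: "(p, M) \<in> R" ..
    show "(\<nu> p, []) \<in> pair ` R" unfolding nil[OF M, symmetric] using M by (rule imageI)
  qed
  then show ?thesis
    using assms by (simp add: sim_output_def xs code_instance_def code_vass_def enc_Pair enc_nat_def)
qed

end

end

text \<open>There is only one vector of dimension 0, so the equation
  \<open>v = M *\<^sub>v u + c\<close> holds automatically and any derivation for \<open>p\<close>
  suffices.\<close>

lemma reach_dimension_0:
  assumes "d = 0" "u \<in> carrier_vec d" "v \<in> carrier_vec d"
  shows "reach V (p, u) (q, v) \<longleftrightarrow> (\<exists>M. (p, M) \<in> R)"
proof -
  have "v = M *\<^sub>v u + c" if "backward V q p M c" for M c
    using backward_closed(3)[OF affine q that] assms by (intro eq_vecI) auto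
  then show ?thesis
    unfolding reach_iff_backward[OF affine q p assms(2)] backward_pairs_def by auto
qed

end

section \<open>The machine without transitions, and the construction as one algorithm\<close>

lemma reach_no_transitions:
  assumes "transitions V = {}"
  shows "reach V c c' \<longleftrightarrow> c \<in> configs V \<and> c = c'"
proof
  assume "reach V c c'"
  then obtain w where "run V w c c'" by (auto simp: reach_def)
  then show "c \<in> configs V \<and> c = c'" using assms by (cases w) auto
qed (auto intro: reach_refl)

lemma norm_trans_empty: "norm_trans {} = 0"
  by (simp add: norm_trans_def)

lemma zero_dimensional_halves:
  fixes u v :: "int vec"
  assumes "u \<in> carrier_vec n" "v \<in> carrier_vec n" "n = 0"
  shows "u @\<^sub>v 0\<^sub>v n = 0\<^sub>v n @\<^sub>v v"
    and "k \<in> Q \<Longrightarrow> (k, u @\<^sub>v 0\<^sub>v n) \<in> configs \<lparr>dimension = 0, states = Q, transitions = T\<rparr>"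
proof -
  show "u @\<^sub>v 0\<^sub>v n = 0\<^sub>v n @\<^sub>v v" using assms by (intro eq_vecI) auto
  show "(k, u @\<^sub>v 0\<^sub>v n) \<in> configs \<lparr>dimension = 0, states = Q, transitions = T\<rparr>" if "k \<in> Q"
    using that assms(3) append_carrier_vec[OF assms(1) zero_carrier_vec[of n]]
    by (simp only: configs_def mem_Times_iff) simp
qed

theorem theorem3p1:
  shows "\<exists>F. partial_recursive F \<and>
    (\<forall>(V :: 'q vass) p q (\<nu> :: 'q \<Rightarrow> nat).
       affine_zvass V \<and> finite_monoid_property V \<and> p \<in> states V \<and> q \<in> states V \<and>
       inj_on \<nu> (states V) \<longrightarrow>
       (\<exists>(V' :: nat vass) p' q'.
          zvass V' \<and> p' \<in> states V' \<and> q' \<in> states V' \<and>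
          F (code_instance \<nu> V p q) = Some (code_instance id V' p' q') \<and>
          dimension V' = 2 * dimension V \<and>
          card (states V') \<le> 3 * card (mat_monoid V) * card (states V) \<and>
          card (transitions V')
            \<le> 4 * dimension V * card (mat_monoid V) * (card (states V) + card (transitions V)) \<and>
          norm_trans (transitions V')
            \<le> int (dimension V) * norm_mats (mat_monoid V) * max 1 (norm_trans (transitions V)) \<and>
          (norm_trans (transitions V) \<ge> 1 \<and>
           (\<forall>B \<in> mat_monoid V. \<forall>(r, A, b, s) \<in> transitions V.
              norm_vec (B *\<^sub>v b) \<le> norm_mats (mat_monoid V) * norm_trans (transitions V)) \<longrightarrow>
           norm_trans (transitions V')
             \<le> norm_mats (mat_monoid V) * norm_trans (transitions V)) \<and>
          (\<forall>u \<in> carrier_vec (dimension V). \<forall>v \<in> carrier_vec (dimension V).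
             reach V (p, u) (q, v) \<longleftrightarrow>
             reach V' (p', u @\<^sub>v 0\<^sub>v (dimension V)) (q', 0\<^sub>v (dimension V) @\<^sub>v v))))"
proof -
  \<comment> \<open>The argument has the shape of an instance: dimension, code of the states, code
    of the transitions, then the names of \<open>p\<close> and \<open>q\<close>. Here the
    transitions are decoded.\<close>
  define ts :: "(nat \<times> nat \<times> nat) \<times> nat \<times> nat \<Rightarrow> list_transition list"
    where "ts x = map dec (elements (snd (snd (fst x))))" for x
  define pairs where "pairs x n = pairs_upto (fst (fst x)) (ts x) (snd (snd x)) n" for x n
  have dec: "decidable (\<lambda>z. closed_pairs (fst (fst (fst z))) (ts (fst z)) (pairs (fst z) (snd z)))"
    unfolding pairs_def ts_def by (intro computable_intros)
  have out: "computable (\<lambda>z. sim_output (fst (fst (fst z))) (ts (fst z)) (fst (snd (fst z))) (snd (snd (fst z)))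
      (pairs (fst z) (snd z)))"
    unfolding pairs_def ts_def by (intro computable_intros)
  obtain F where rec: "partial_recursive F" and F: "\<And>x. \<exists>n. closed_pairs (fst (fst x)) (ts x) (pairs x n) \<Longrightarrow>
      \<exists>n. closed_pairs (fst (fst x)) (ts x) (pairs x n) \<and>
        F (enc x) = Some (enc (sim_output (fst (fst x)) (ts x) (fst (snd x)) (snd (snd x)) (pairs x n)))"
    using partial_recursive_search[OF dec out] by blast
  show ?thesis
  proof (intro exI[of _ F] conjI rec allI impI, goal_cases)
    case (1 V p q \<nu>)
    then interpret simulation \<nu> V p q
      by unfold_locales (auto simp: finite_monoid_property_def)
    define x where "x = ((d, set_encode (\<nu> ` states V), set_encode (code_transition \<nu> ` transitions V)), \<nu> p, \<nu> q)"
    have x: "enc x = code_instance \<nu> V p q"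
      by (simp add: x_def code_instance_def code_vass_def enc_Pair enc_nat_def)
    have "set (ts x) = dec ` code_transition \<nu> ` transitions V"
      using finite_transitions by (simp add: ts_def x_def)
    also have "\<dots> = transition_list \<nu> ` transitions V"
      by (simp add: image_image flip: enc_transition_list)
    finally have ts: "set (ts x) = transition_list \<nu> ` transitions V" .
    have "\<exists>n. closed_pairs (fst (fst x)) (ts x) (pairs x n)"
      using ex_closed_pairs[OF ts] by (simp add: pairs_def x_def)
    from F[OF this] obtain n where "closed_pairs d (ts x) (pairs_upto d (ts x) (\<nu> q) n)"
      and Fx: "F (code_instance \<nu> V p q) =
        Some (enc (sim_output d (ts x) (\<nu> p) (\<nu> q) (pairs_upto d (ts x) (\<nu> q) n)))"
      unfolding x[symmetric] by (auto simp: pairs_def x_def)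
    then have pairs: "set (pairs_upto d (ts x) (\<nu> q) n) = pair ` R"
      using closed_pairs_eq[OF ts] by blast
    have nonneg: "0 \<le> norm_mats (mat_monoid V)" "0 \<le> norm_trans (transitions V)"
      using norm_mats_nonneg[OF fin_monoid] norm_trans_nonneg[OF finite_transitions] .
    show ?case
    proof (cases "d = 0")
      case True
      let ?V = "\<lparr>dimension = 0, states = {0, 1}, transitions = {}\<rparr> :: nat vass"
      have card: "3 * 1 * 1 \<le> 3 * card (mat_monoid V) * card (states V)"
        using card_monoid_pos card_states_pos by (intro mult_le_mono order_refl)
      show ?thesis
      proof (rule exI[of _ ?V], rule exI[of _ 0], rule exI[of _ "if \<exists>M. (p, M) \<in> R then 0 else 1"],
          intro conjI impI ballI, goal_cases)
        case 4
        show ?case using Fx[unfolded sim_output_dimension_0[OF ts pairs True]] .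
      next
        case 6
        have "card (states ?V) \<le> 3 * 1 * 1" by simp
        then show ?case using card by (rule order_trans)
      next
        case 9
        show ?case using nonneg by (simp add: norm_trans_empty)
      next
        case (10 u v)
        \<comment> \<open>Without transitions, reaching means being equal. Both vectors are empty,
          so it comes down to whether the chosen target is 0.\<close>
        have "transitions ?V = {}" by simp
        from reach_no_transitions[OF this] zero_dimensional_halves(1)[OF 10 True]
          zero_dimensional_halves(2)[OF 10 True, of 0 "{0, Suc 0}" "{}"] reach_dimension_0[OF True 10]
        show ?case by simp
      qed (simp_all add: True zvass_def affine_zvass_def norm_trans_empty)
    next
      case False
      \<comment> \<open>The loops need \<open>K\<close> to dominate the norm of the monoid by
        itself; this holds since \<open>d\<close> and \<open>max 1\<close> of the transition norm
        are both at least 1.\<close>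
      have max_norm: "norm_mats (mat_monoid V) \<le> int d * norm_mats (mat_monoid V) * max 1 (norm_trans (transitions V))"
      proof -
        have "norm_mats (mat_monoid V) * 1 * 1 \<le> norm_mats (mat_monoid V) * int d * max 1 (norm_trans (transitions V))"
          using False nonneg by (intro mult_mono) auto
        then show ?thesis by (simp add: mult.commute)
      qed
      have bound: "norm_vec (B *\<^sub>v b) \<le> int d * norm_mats (mat_monoid V) * max 1 (norm_trans (transitions V))"
        if "B \<in> mat_monoid V" "(r, A, b, s) \<in> transitions V" for B r A b s
      proof -
        have "norm_vec (B *\<^sub>v b) \<le> int d * norm_mat B * norm_vec b"
          using norm_mult_mat_vec_le mat_monoid_carrier[OF affine that(1)] transitionsD(3)[OF that(2)] .
        also have "\<dots> \<le> int d * norm_mats (mat_monoid V) * max 1 (norm_trans (transitions V))"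
          using norm_mats_ge[OF fin_monoid that(1)] norm_trans_ge[OF finite_transitions that(2)] nonneg
          by (intro mult_mono) (auto simp: norm_vec_nonneg norm_mat_nonneg)
        finally show ?thesis .
      qed
      \<comment> \<open>In the sharper estimate the premise that the transition norm is at least 1
        takes over the role of \<open>max 1\<close>.\<close>
      have "norm_mats (mat_monoid V) \<le> norm_mats (mat_monoid V) * norm_trans (transitions V)"
        if "1 \<le> norm_trans (transitions V)"
        using mult_left_mono[OF that nonneg(1)] by simp
      then have "norm_trans (sim_transitions \<nu> V p q) \<le> norm_mats (mat_monoid V) * norm_trans (transitions V)"
        if "1 \<le> norm_trans (transitions V)" "\<forall>B \<in> mat_monoid V. \<forall>(r, A, b, s) \<in> transitions V.
              norm_vec (B *\<^sub>v b) \<le> norm_mats (mat_monoid V) * norm_trans (transitions V)"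
        using that by (intro norm_sim_transitions_le[OF False]) auto
      note conditional_bound = this
      show ?thesis
      proof (rule exI[of _ "sim \<nu> V p q"], rule exI[of _ "node \<nu> q (1\<^sub>m d)"], rule exI[of _ final],
          intro conjI impI ballI, goal_cases)
        case 2
        show ?case using backward_pairs_start[of q V] by (auto simp: sim_states_def)
      next
        case 3
        show ?case by (simp add: sim_states_def)
      next
        case 4
        show ?case using Fx[unfolded sim_output_eq_code_instance[OF ts pairs False]] .
      next
        case 8
        show ?case using norm_sim_transitions_le[OF False max_norm bound] by simp
      next
        case 9
        then show ?case using conditional_bound by simp
      next
        case (10 u v)
        then show ?case by (rule reach_sim_iff)
      qed (simp_all add: zvass_sim card_sim_states card_sim_transitions[OF False])
    qed
  qed
qed

end
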